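(* Let $A$ be a commutative 2-ring and $G$ a small groupoid. If $\alpha$ and $\beta$ are 1-morphisms of 2-rings from ${}^G\mathrm{Set}$ to $A$ and $\chi:\alpha\Rightarrow\beta$ is a 2-morphism, then $\chi$ is an isomorphism.
   Context: Presentable category: a locally small cocomplete category that is the closure under small colimits of a small set of little objects ($x$ is little if, for some cardinal $\kappa$, $\mathrm{Hom}(x,-)$ preserves $\kappa$-directed colimits). A 2-ring is a presentable monoidal category whose tensor product preserves small colimits in each variable; a 1-morphism of 2-rings is a cocontinuous (strong) monoidal functor, and a 2-morphism is a monoidal natural transformation. A commutative 2-ring is a 2-ring equipped with a symmetric structure. ${}^G\mathrm{Set}=\mathrm{Fun}(G,\mathrm{Set})$ is a commutative 2-ring with $\otimes=\times$. *)

theory Defs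
  imports Main "HOL-Library.FuncSet"
begin

unbundle cardinal_syntax

section \<open>Universe and smallness\<close>

text \<open>
  A type \<open>'u\<close> of inaccessible cardinality plays the role of a Grothendieck universe: a set (over
  any type) is small if it has fewer elements than \<open>'u\<close>. Small sets are thus represented, up to
  bijection, by the small subsets of \<open>'u\<close>.
\<close>

definition small :: "'u itself \<Rightarrow> 'b set \<Rightarrow> bool" where
  "small U A \<longleftrightarrow> |A| <o |UNIV :: 'u set|"

definition inaccessible :: "'u itself \<Rightarrow> bool" where
  "inaccessible U \<longleftrightarrow>
     natLeq <o |UNIV :: 'u set| \<and>
     regularCard |UNIV :: 'u set| \<and>
     (\<forall>A :: 'u set. small U A \<longrightarrow> small U (Pow A))"

section \<open>Categories, functors, natural transformations\<close>

record ('o, 'a) cat =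
  Ob :: "'o set"
  Ar :: "'a set"
  Src :: "'a \<Rightarrow> 'o"
  Tgt :: "'a \<Rightarrow> 'o"
  Ident :: "'o \<Rightarrow> 'a"
  Cmp :: "'a \<Rightarrow> 'a \<Rightarrow> 'a"  (infixl \<open>\<cdot>\<index>\<close> 65)

text \<open>\<open>g \<cdot> f\<close> is \<open>g\<close> after \<open>f\<close>.\<close>

definition Hom :: "('o, 'a, 'x) cat_scheme \<Rightarrow> 'o \<Rightarrow> 'o \<Rightarrow> 'a set" where
  "Hom C x y = {f \<in> Ar C. Src C f = x \<and> Tgt C f = y}"

locale category =
  fixes C :: "('o, 'a, 'x) cat_scheme" (structure)
  assumes Src_in: "f \<in> Ar C \<Longrightarrow> Src C f \<in> Ob C"
    and Tgt_in: "f \<in> Ar C \<Longrightarrow> Tgt C f \<in> Ob C"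
    and Ident_in: "x \<in> Ob C \<Longrightarrow> Ident C x \<in> Hom C x x"
    and Cmp_in: "f \<in> Hom C x y \<Longrightarrow> g \<in> Hom C y z \<Longrightarrow> g \<cdot> f \<in> Hom C x z"
    and Cmp_Ident_right: "f \<in> Hom C x y \<Longrightarrow> f \<cdot> Ident C x = f"
    and Cmp_Ident_left: "f \<in> Hom C x y \<Longrightarrow> Ident C y \<cdot> f = f"
    and Cmp_assoc: "f \<in> Hom C w x \<Longrightarrow> g \<in> Hom C x y \<Longrightarrow> h \<in> Hom C y z \<Longrightarrow>
      h \<cdot> (g \<cdot> f) = (h \<cdot> g) \<cdot> f"

definition is_iso :: "('o, 'a, 'x) cat_scheme \<Rightarrow> 'a \<Rightarrow> bool" where
  "is_iso C f \<longleftrightarrow> f \<in> Ar C \<and>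
     (\<exists>g \<in> Hom C (Tgt C f) (Src C f).
        g \<cdot>\<^bsub>C\<^esub> f = Ident C (Src C f) \<and> f \<cdot>\<^bsub>C\<^esub> g = Ident C (Tgt C f))"

locale groupoid = category C for C :: "('o, 'a, 'x) cat_scheme" (structure) +
  assumes all_iso: "f \<in> Ar C \<Longrightarrow> is_iso C f"

record ('o, 'a, 'p, 'b) fctr =
  FOb :: "'o \<Rightarrow> 'p"
  FAr :: "'a \<Rightarrow> 'b"

locale is_functor = C: category C + D: category D
  for C :: "('o, 'a, 'x) cat_scheme" and D :: "('p, 'b, 'y) cat_scheme"
    and F :: "('o, 'a, 'p, 'b, 'z) fctr_scheme" +
  assumes FOb_in: "x \<in> Ob C \<Longrightarrow> FOb F x \<in> Ob D"
    and FAr_in: "f \<in> Hom C x y \<Longrightarrow> FAr F f \<in> Hom D (FOb F x) (FOb F y)"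
    and FAr_Ident: "x \<in> Ob C \<Longrightarrow> FAr F (Ident C x) = Ident D (FOb F x)"
    and FAr_Cmp: "f \<in> Hom C x y \<Longrightarrow> g \<in> Hom C y z \<Longrightarrow>
      FAr F (g \<cdot>\<^bsub>C\<^esub> f) = FAr F g \<cdot>\<^bsub>D\<^esub> FAr F f"

definition fctr_comp ::
  "('p, 'b, 'q, 'c, 'z) fctr_scheme \<Rightarrow> ('o, 'a, 'p, 'b, 'w) fctr_scheme \<Rightarrow> ('o, 'a, 'q, 'c) fctr"
  where "fctr_comp H F = \<lparr>FOb = (\<lambda>x. FOb H (FOb F x)), FAr = (\<lambda>f. FAr H (FAr F f))\<rparr>"

locale nat_trans = F: is_functor C D F + H: is_functor C D H
  for C :: "('o, 'a, 'x) cat_scheme" and D :: "('p, 'b, 'y) cat_scheme"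
    and F :: "('o, 'a, 'p, 'b, 'z) fctr_scheme" and H :: "('o, 'a, 'p, 'b, 'w) fctr_scheme"
    and \<tau> :: "'o \<Rightarrow> 'b" +
  assumes component_in: "x \<in> Ob C \<Longrightarrow> \<tau> x \<in> Hom D (FOb F x) (FOb H x)"
    and natural: "f \<in> Hom C x y \<Longrightarrow> \<tau> y \<cdot>\<^bsub>D\<^esub> FAr F f = FAr H f \<cdot>\<^bsub>D\<^esub> \<tau> x"

datatype ('o, 't) arrow = Arrow (src: 'o) (tgt: 'o) (body: 't)

text \<open>Functors and components are taken extensional, so that equality is equality of data on \<open>C\<close>.\<close>

definition fun_cat :: "('o, 'a, 'x) cat_scheme \<Rightarrow> ('p, 'b, 'y) cat_scheme \<Rightarrow>
    (('o, 'a, 'p, 'b) fctr, (('o, 'a, 'p, 'b) fctr, 'o \<Rightarrow> 'b) arrow) cat" where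
  "fun_cat C D = (let
      obs = {F. is_functor C D F \<and> FOb F \<in> extensional (Ob C) \<and> FAr F \<in> extensional (Ar C)}
    in \<lparr>Ob = obs,
        Ar = {Arrow F H \<tau> | F H \<tau>.
          F \<in> obs \<and> H \<in> obs \<and> nat_trans C D F H \<tau> \<and> \<tau> \<in> extensional (Ob C)},
        Src = src,
        Tgt = tgt,
        Ident = (\<lambda>F. Arrow F F (\<lambda>x\<in>Ob C. Ident D (FOb F x))),
        Cmp = (\<lambda>t s. Arrow (src s) (tgt t) (\<lambda>x\<in>Ob C. body t x \<cdot>\<^bsub>D\<^esub> body s x))\<rparr>)"

section \<open>The category of small sets\<close>

definition set_cat :: "('u set, ('u set, 'u \<Rightarrow> 'u) arrow) cat" where
  "set_cat = \<lparr>Ob = {X. small TYPE('u) X},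
     Ar = {Arrow X Y f | X Y f. small TYPE('u) X \<and> small TYPE('u) Y \<and> f \<in> X \<rightarrow>\<^sub>E Y},
     Src = src,
     Tgt = tgt,
     Ident = (\<lambda>X. Arrow X X (\<lambda>u\<in>X. u)),
     Cmp = (\<lambda>g f. Arrow (src f) (tgt g) (compose (src f) (body g) (body f)))\<rparr>"

text \<open>
  \<open>code\<close> replaces a small set over an arbitrary type by a chosen isomorphic object of \<open>set_cat\<close>,
  and \<open>code_map A B f\<close> is the arrow corresponding to \<open>f : A \<rightarrow> B\<close>.
\<close>

definition enc :: "'b set \<Rightarrow> 'b \<Rightarrow> 'u" where
  "enc A = (SOME e. inj_on e A)"

definition code :: "'b set \<Rightarrow> 'u set" where
  "code A = enc A ` A"

definition dec :: "'b set \<Rightarrow> 'u \<Rightarrow> 'b" where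
  "dec A = inv_into A (enc A)"

definition code_map :: "'b set \<Rightarrow> 'c set \<Rightarrow> ('b \<Rightarrow> 'c) \<Rightarrow> ('u set, 'u \<Rightarrow> 'u) arrow" where
  "code_map A B f = Arrow (code A) (code B) (\<lambda>u\<in>code A. enc B (f (dec A u)))"

definition hom_fctr :: "('o, 'a, 'x) cat_scheme \<Rightarrow> 'o \<Rightarrow>
    ('o, 'a, 'u set, ('u set, 'u \<Rightarrow> 'u) arrow) fctr" where
  "hom_fctr C x = \<lparr>FOb = (\<lambda>y. code (Hom C x y)),
     FAr = (\<lambda>f. code_map (Hom C x (Src C f)) (Hom C x (Tgt C f)) (\<lambda>h. f \<cdot>\<^bsub>C\<^esub> h))\<rparr>"

section \<open>Colimits and presentable categories\<close>

definition cocone :: "('j, 'k, 'x) cat_scheme \<Rightarrow> ('o, 'a, 'y) cat_scheme \<Rightarrow>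
    ('j, 'k, 'o, 'a, 'z) fctr_scheme \<Rightarrow> 'o \<Rightarrow> ('j \<Rightarrow> 'a) \<Rightarrow> bool" where
  "cocone J C D c \<iota> \<longleftrightarrow> is_functor J C D \<and> c \<in> Ob C \<and>
     (\<forall>j \<in> Ob J. \<iota> j \<in> Hom C (FOb D j) c) \<and>
     (\<forall>k \<in> Ar J. \<iota> (Tgt J k) \<cdot>\<^bsub>C\<^esub> FAr D k = \<iota> (Src J k))"

definition colimit :: "('j, 'k, 'x) cat_scheme \<Rightarrow> ('o, 'a, 'y) cat_scheme \<Rightarrow>
    ('j, 'k, 'o, 'a, 'z) fctr_scheme \<Rightarrow> 'o \<Rightarrow> ('j \<Rightarrow> 'a) \<Rightarrow> bool" where
  "colimit J C D c \<iota> \<longleftrightarrow> cocone J C D c \<iota> \<and>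
     (\<forall>d \<kappa>. cocone J C D d \<kappa> \<longrightarrow>
        (\<exists>!h. h \<in> Hom C c d \<and> (\<forall>j \<in> Ob J. h \<cdot>\<^bsub>C\<^esub> \<iota> j = \<kappa> j)))"

text \<open>Every small category is isomorphic to one whose objects and arrows are elements of \<open>'u\<close>.\<close>

definition small_category :: "('u, 'u) cat \<Rightarrow> bool" where
  "small_category J \<longleftrightarrow> category J \<and> small TYPE('u) (Ob J) \<and> small TYPE('u) (Ar J)"

definition preserves_colimits :: "('u, 'u) cat \<Rightarrow> ('o, 'a, 'x) cat_scheme \<Rightarrow>
    ('p, 'b, 'y) cat_scheme \<Rightarrow> ('o, 'a, 'p, 'b, 'z) fctr_scheme \<Rightarrow> bool" where
  "preserves_colimits J C D F \<longleftrightarrow>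
     (\<forall>(K :: ('u, 'u, 'o, 'a) fctr) c \<iota>. colimit J C K c \<iota> \<longrightarrow>
        colimit J D (fctr_comp F K) (FOb F c) (\<lambda>j. FAr F (\<iota> j)))"

definition cocontinuous :: "'u itself \<Rightarrow> ('o, 'a, 'x) cat_scheme \<Rightarrow>
    ('p, 'b, 'y) cat_scheme \<Rightarrow> ('o, 'a, 'p, 'b, 'z) fctr_scheme \<Rightarrow> bool" where
  "cocontinuous U C D F \<longleftrightarrow> is_functor C D F \<and>
     (\<forall>J :: ('u, 'u) cat. small_category J \<longrightarrow> preserves_colimits J C D F)"

definition cocomplete :: "'u itself \<Rightarrow> ('o, 'a, 'x) cat_scheme \<Rightarrow> bool" where
  "cocomplete U C \<longleftrightarrow> category C \<and>
     (\<forall>(J :: ('u, 'u) cat) (K :: ('u, 'u, 'o, 'a) fctr).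
        small_category J \<and> is_functor J C K \<longrightarrow> (\<exists>c \<iota>. colimit J C K c \<iota>))"

definition locally_small :: "'u itself \<Rightarrow> ('o, 'a, 'x) cat_scheme \<Rightarrow> bool" where
  "locally_small U C \<longleftrightarrow> category C \<and> (\<forall>x \<in> Ob C. \<forall>y \<in> Ob C. small U (Hom C x y))"

definition is_poset :: "('o, 'a, 'x) cat_scheme \<Rightarrow> bool" where
  "is_poset J \<longleftrightarrow> category J \<and>
     (\<forall>i \<in> Ob J. \<forall>j \<in> Ob J. \<forall>f \<in> Hom J i j. \<forall>g \<in> Hom J i j. f = g) \<and>
     (\<forall>i \<in> Ob J. \<forall>j \<in> Ob J. Hom J i j \<noteq> {} \<and> Hom J j i \<noteq> {} \<longrightarrow> i = j)"

definition directed_poset :: "'u rel \<Rightarrow> ('o, 'a, 'x) cat_scheme \<Rightarrow> bool" where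
  "directed_poset \<kappa> J \<longleftrightarrow> is_poset J \<and>
     (\<forall>S \<subseteq> Ob J. |S| <o \<kappa> \<longrightarrow> (\<exists>j \<in> Ob J. \<forall>i \<in> S. Hom J i j \<noteq> {}))"

text \<open>
  The cardinal \<open>\<kappa>\<close> has to be small: a small poset that is directed for the size of the universe
  has a greatest element.
\<close>

definition little :: "'u itself \<Rightarrow> ('o, 'a, 'x) cat_scheme \<Rightarrow> 'o \<Rightarrow> bool" where
  "little U C x \<longleftrightarrow> x \<in> Ob C \<and>
     (\<exists>\<kappa> :: 'u rel. Card_order \<kappa> \<and> small U (Field \<kappa>) \<and>
        (\<forall>J :: ('u, 'u) cat. small_category J \<and> directed_poset \<kappa> J \<longrightarrow>
           preserves_colimits J C
             (set_cat :: ('u set, ('u set, 'u \<Rightarrow> 'u) arrow) cat) (hom_fctr C x)))"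

inductive_set colim_closure :: "'u itself \<Rightarrow> ('o, 'a, 'x) cat_scheme \<Rightarrow> 'o set \<Rightarrow> 'o set"
  for U :: "'u itself" and C :: "('o, 'a, 'x) cat_scheme" and S :: "'o set" where
  base: "x \<in> S \<Longrightarrow> x \<in> colim_closure U C S"
| colim: "small_category (J :: ('u, 'u) cat) \<Longrightarrow> colimit J C (K :: ('u, 'u, 'o, 'a) fctr) c \<iota> \<Longrightarrow>
    (\<And>j. j \<in> Ob J \<Longrightarrow> FOb K j \<in> colim_closure U C S) \<Longrightarrow> c \<in> colim_closure U C S"

definition presentable :: "'u itself \<Rightarrow> ('o, 'a, 'x) cat_scheme \<Rightarrow> bool" where
  "presentable U C \<longleftrightarrow> locally_small U C \<and> cocomplete U C \<and>
     (\<exists>S \<subseteq> Ob C. small U S \<and> (\<forall>x \<in> S. little U C x) \<and> Ob C = colim_closure U C S)"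

section \<open>Monoidal categories\<close>

text \<open>\<open>\<otimes>\<close> is the tensor product on objects, \<open>\<boxtimes>\<close> the one on arrows.\<close>

record ('o, 'a) moncat = "('o, 'a) cat" +
  TOb :: "'o \<Rightarrow> 'o \<Rightarrow> 'o"  (infixl \<open>\<otimes>\<index>\<close> 75)
  TAr :: "'a \<Rightarrow> 'a \<Rightarrow> 'a"  (infixl \<open>\<boxtimes>\<index>\<close> 75)
  Unit :: 'o
  Assoc :: "'o \<Rightarrow> 'o \<Rightarrow> 'o \<Rightarrow> 'a"
  Lunit :: "'o \<Rightarrow> 'a"
  Runit :: "'o \<Rightarrow> 'a"

record ('o, 'a) symcat = "('o, 'a) moncat" +
  Braid :: "'o \<Rightarrow> 'o \<Rightarrow> 'a"

locale monoidal_category = category C for C :: "('o, 'a, 'x) moncat_scheme" (structure) +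
  assumes TOb_in: "x \<in> Ob C \<Longrightarrow> y \<in> Ob C \<Longrightarrow> x \<otimes> y \<in> Ob C"
    and TAr_in: "f \<in> Hom C x y \<Longrightarrow> g \<in> Hom C x' y' \<Longrightarrow> f \<boxtimes> g \<in> Hom C (x \<otimes> x') (y \<otimes> y')"
    and TAr_Ident: "x \<in> Ob C \<Longrightarrow> y \<in> Ob C \<Longrightarrow> Ident C x \<boxtimes> Ident C y = Ident C (x \<otimes> y)"
    and TAr_Cmp: "f \<in> Hom C x y \<Longrightarrow> g \<in> Hom C y z \<Longrightarrow> f' \<in> Hom C x' y' \<Longrightarrow> g' \<in> Hom C y' z' \<Longrightarrow>
      (g \<cdot> f) \<boxtimes> (g' \<cdot> f') = (g \<boxtimes> g') \<cdot> (f \<boxtimes> f')"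
    and Unit_in: "Unit C \<in> Ob C"
    and Assoc_in: "x \<in> Ob C \<Longrightarrow> y \<in> Ob C \<Longrightarrow> z \<in> Ob C \<Longrightarrow>
      Assoc C x y z \<in> Hom C ((x \<otimes> y) \<otimes> z) (x \<otimes> (y \<otimes> z))"
    and Assoc_iso: "x \<in> Ob C \<Longrightarrow> y \<in> Ob C \<Longrightarrow> z \<in> Ob C \<Longrightarrow> is_iso C (Assoc C x y z)"
    and Assoc_natural: "f \<in> Hom C x x' \<Longrightarrow> g \<in> Hom C y y' \<Longrightarrow> h \<in> Hom C z z' \<Longrightarrow>
      Assoc C x' y' z' \<cdot> ((f \<boxtimes> g) \<boxtimes> h) = (f \<boxtimes> (g \<boxtimes> h)) \<cdot> Assoc C x y z"
    and Lunit_in: "x \<in> Ob C \<Longrightarrow> Lunit C x \<in> Hom C (Unit C \<otimes> x) x"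
    and Lunit_iso: "x \<in> Ob C \<Longrightarrow> is_iso C (Lunit C x)"
    and Lunit_natural: "f \<in> Hom C x y \<Longrightarrow>
      Lunit C y \<cdot> (Ident C (Unit C) \<boxtimes> f) = f \<cdot> Lunit C x"
    and Runit_in: "x \<in> Ob C \<Longrightarrow> Runit C x \<in> Hom C (x \<otimes> Unit C) x"
    and Runit_iso: "x \<in> Ob C \<Longrightarrow> is_iso C (Runit C x)"
    and Runit_natural: "f \<in> Hom C x y \<Longrightarrow>
      Runit C y \<cdot> (f \<boxtimes> Ident C (Unit C)) = f \<cdot> Runit C x"
    and triangle: "x \<in> Ob C \<Longrightarrow> y \<in> Ob C \<Longrightarrow>
      (Ident C x \<boxtimes> Lunit C y) \<cdot> Assoc C x (Unit C) y = Runit C x \<boxtimes> Ident C y"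
    and pentagon: "w \<in> Ob C \<Longrightarrow> x \<in> Ob C \<Longrightarrow> y \<in> Ob C \<Longrightarrow> z \<in> Ob C \<Longrightarrow>
      Assoc C w x (y \<otimes> z) \<cdot> Assoc C (w \<otimes> x) y z =
      (Ident C w \<boxtimes> Assoc C x y z) \<cdot> Assoc C w (x \<otimes> y) z \<cdot> (Assoc C w x y \<boxtimes> Ident C z)"

locale symmetric_monoidal_category =
  monoidal_category C for C :: "('o, 'a, 'x) symcat_scheme" (structure) +
  assumes Braid_in: "x \<in> Ob C \<Longrightarrow> y \<in> Ob C \<Longrightarrow> Braid C x y \<in> Hom C (x \<otimes> y) (y \<otimes> x)"
    and Braid_natural: "f \<in> Hom C x x' \<Longrightarrow> g \<in> Hom C y y' \<Longrightarrow>
      Braid C x' y' \<cdot> (f \<boxtimes> g) = (g \<boxtimes> f) \<cdot> Braid C x y"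
    and Braid_inverse: "x \<in> Ob C \<Longrightarrow> y \<in> Ob C \<Longrightarrow> Braid C y x \<cdot> Braid C x y = Ident C (x \<otimes> y)"
    and hexagon: "x \<in> Ob C \<Longrightarrow> y \<in> Ob C \<Longrightarrow> z \<in> Ob C \<Longrightarrow>
      Assoc C y z x \<cdot> Braid C x (y \<otimes> z) \<cdot> Assoc C x y z =
      (Ident C y \<boxtimes> Braid C x z) \<cdot> Assoc C y x z \<cdot> (Braid C x y \<boxtimes> Ident C z)"

record ('o, 'a, 'p, 'b) monfctr = "('o, 'a, 'p, 'b) fctr" +
  Mult :: "'o \<Rightarrow> 'o \<Rightarrow> 'b"
  MUnit :: 'b

locale monoidal_functor = C: monoidal_category C + D: monoidal_category D + is_functor C D F
  for C :: "('o, 'a, 'x) moncat_scheme" and D :: "('p, 'b, 'y) moncat_scheme"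
    and F :: "('o, 'a, 'p, 'b, 'z) monfctr_scheme" +
  assumes Mult_in: "x \<in> Ob C \<Longrightarrow> y \<in> Ob C \<Longrightarrow>
      Mult F x y \<in> Hom D (FOb F x \<otimes>\<^bsub>D\<^esub> FOb F y) (FOb F (x \<otimes>\<^bsub>C\<^esub> y))"
    and Mult_iso: "x \<in> Ob C \<Longrightarrow> y \<in> Ob C \<Longrightarrow> is_iso D (Mult F x y)"
    and Mult_natural: "f \<in> Hom C x x' \<Longrightarrow> g \<in> Hom C y y' \<Longrightarrow>
      Mult F x' y' \<cdot>\<^bsub>D\<^esub> (FAr F f \<boxtimes>\<^bsub>D\<^esub> FAr F g) = FAr F (f \<boxtimes>\<^bsub>C\<^esub> g) \<cdot>\<^bsub>D\<^esub> Mult F x y"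
    and MUnit_in: "MUnit F \<in> Hom D (Unit D) (FOb F (Unit C))"
    and MUnit_iso: "is_iso D (MUnit F)"
    and Mult_Assoc: "x \<in> Ob C \<Longrightarrow> y \<in> Ob C \<Longrightarrow> z \<in> Ob C \<Longrightarrow>
      FAr F (Assoc C x y z) \<cdot>\<^bsub>D\<^esub> Mult F (x \<otimes>\<^bsub>C\<^esub> y) z \<cdot>\<^bsub>D\<^esub> (Mult F x y \<boxtimes>\<^bsub>D\<^esub> Ident D (FOb F z)) =
      Mult F x (y \<otimes>\<^bsub>C\<^esub> z) \<cdot>\<^bsub>D\<^esub> (Ident D (FOb F x) \<boxtimes>\<^bsub>D\<^esub> Mult F y z) \<cdot>\<^bsub>D\<^esub>
        Assoc D (FOb F x) (FOb F y) (FOb F z)"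
    and Mult_Lunit: "x \<in> Ob C \<Longrightarrow>
      FAr F (Lunit C x) \<cdot>\<^bsub>D\<^esub> Mult F (Unit C) x \<cdot>\<^bsub>D\<^esub> (MUnit F \<boxtimes>\<^bsub>D\<^esub> Ident D (FOb F x)) =
      Lunit D (FOb F x)"
    and Mult_Runit: "x \<in> Ob C \<Longrightarrow>
      FAr F (Runit C x) \<cdot>\<^bsub>D\<^esub> Mult F x (Unit C) \<cdot>\<^bsub>D\<^esub> (Ident D (FOb F x) \<boxtimes>\<^bsub>D\<^esub> MUnit F) =
      Runit D (FOb F x)"

locale monoidal_nat_trans =
  F: monoidal_functor C D F + H: monoidal_functor C D H + nat_trans C D F H \<tau>
  for C :: "('o, 'a, 'x) moncat_scheme" and D :: "('p, 'b, 'y) moncat_scheme"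
    and F :: "('o, 'a, 'p, 'b, 'z) monfctr_scheme" and H :: "('o, 'a, 'p, 'b, 'w) monfctr_scheme"
    and \<tau> :: "'o \<Rightarrow> 'b" +
  assumes component_Mult: "x \<in> Ob C \<Longrightarrow> y \<in> Ob C \<Longrightarrow>
      \<tau> (x \<otimes>\<^bsub>C\<^esub> y) \<cdot>\<^bsub>D\<^esub> Mult F x y = Mult H x y \<cdot>\<^bsub>D\<^esub> (\<tau> x \<boxtimes>\<^bsub>D\<^esub> \<tau> y)"
    and component_Unit: "\<tau> (Unit C) \<cdot>\<^bsub>D\<^esub> MUnit F = MUnit H"

section \<open>2-rings\<close>

definition tensor_left :: "('o, 'a, 'x) moncat_scheme \<Rightarrow> 'o \<Rightarrow> ('o, 'a, 'o, 'a) fctr" where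
  "tensor_left C x = \<lparr>FOb = (\<lambda>y. x \<otimes>\<^bsub>C\<^esub> y), FAr = (\<lambda>f. Ident C x \<boxtimes>\<^bsub>C\<^esub> f)\<rparr>"

definition tensor_right :: "('o, 'a, 'x) moncat_scheme \<Rightarrow> 'o \<Rightarrow> ('o, 'a, 'o, 'a) fctr" where
  "tensor_right C x = \<lparr>FOb = (\<lambda>y. y \<otimes>\<^bsub>C\<^esub> x), FAr = (\<lambda>f. f \<boxtimes>\<^bsub>C\<^esub> Ident C x)\<rparr>"

definition two_ring :: "'u itself \<Rightarrow> ('o, 'a, 'x) moncat_scheme \<Rightarrow> bool" where
  "two_ring U R \<longleftrightarrow> presentable U R \<and> monoidal_category R \<and>
     (\<forall>x \<in> Ob R. cocontinuous U R R (tensor_left R x) \<and> cocontinuous U R R (tensor_right R x))"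

definition commutative_two_ring :: "'u itself \<Rightarrow> ('o, 'a, 'x) symcat_scheme \<Rightarrow> bool" where
  "commutative_two_ring U R \<longleftrightarrow> two_ring U R \<and> symmetric_monoidal_category R"

text \<open>
  1-morphisms of 2-rings are not required to be compatible with symmetries, even between
  commutative 2-rings.
\<close>

definition two_ring_1mor :: "'u itself \<Rightarrow> ('o, 'a, 'x) moncat_scheme \<Rightarrow>
    ('p, 'b, 'y) moncat_scheme \<Rightarrow> ('o, 'a, 'p, 'b, 'z) monfctr_scheme \<Rightarrow> bool" where
  "two_ring_1mor U R S F \<longleftrightarrow> monoidal_functor R S F \<and> cocontinuous U R S F"

definition two_ring_2mor :: "'u itself \<Rightarrow> ('o, 'a, 'x) moncat_scheme \<Rightarrow>
    ('p, 'b, 'y) moncat_scheme \<Rightarrow> ('o, 'a, 'p, 'b, 'z) monfctr_scheme \<Rightarrow>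
    ('o, 'a, 'p, 'b, 'w) monfctr_scheme \<Rightarrow> ('o \<Rightarrow> 'b) \<Rightarrow> bool" where
  "two_ring_2mor U R S F H \<chi> \<longleftrightarrow>
     two_ring_1mor U R S F \<and> two_ring_1mor U R S H \<and> monoidal_nat_trans R S F H \<chi>"

definition two_ring_2iso :: "'u itself \<Rightarrow> ('o, 'a, 'x) moncat_scheme \<Rightarrow>
    ('p, 'b, 'y) moncat_scheme \<Rightarrow> ('o, 'a, 'p, 'b, 'z) monfctr_scheme \<Rightarrow>
    ('o, 'a, 'p, 'b, 'w) monfctr_scheme \<Rightarrow> ('o \<Rightarrow> 'b) \<Rightarrow> bool" where
  "two_ring_2iso U R S F H \<chi> \<longleftrightarrow> two_ring_2mor U R S F H \<chi> \<and>
     (\<exists>\<psi>. two_ring_2mor U R S H F \<psi> \<and>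
        (\<forall>x \<in> Ob R. \<psi> x \<cdot>\<^bsub>S\<^esub> \<chi> x = Ident S (FOb F x) \<and> \<chi> x \<cdot>\<^bsub>S\<^esub> \<psi> x = Ident S (FOb H x)))"

section \<open>The commutative 2-ring of functors from a small groupoid to sets\<close>

text \<open>Small sets with the cartesian product, carried over to \<open>set_cat\<close> by \<open>code\<close>.\<close>

definition set_sym :: "('u set, ('u set, 'u \<Rightarrow> 'u) arrow) symcat" where
  "set_sym = (let
      cart = (\<lambda>X Y. code (X \<times> Y)) :: 'u set \<Rightarrow> 'u set \<Rightarrow> 'u set;
      pt = code {()} :: 'u set;
      S = set_cat :: ('u set, ('u set, 'u \<Rightarrow> 'u) arrow) cat
    in \<lparr>Ob = Ob S, Ar = Ar S, Src = Src S, Tgt = Tgt S, Ident = Ident S, Cmp = Cmp S,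
        TOb = cart,
        TAr = (\<lambda>f g. code_map (src f \<times> src g) (tgt f \<times> tgt g) (map_prod (body f) (body g))),
        Unit = pt,
        Assoc = (\<lambda>X Y Z. code_map (cart X Y \<times> Z) (X \<times> cart Y Z)
          (\<lambda>(p, z). case dec (X \<times> Y) p of (x, y) \<Rightarrow> (x, enc (Y \<times> Z) (y, z)))),
        Lunit = (\<lambda>X. Arrow (cart pt X) X (\<lambda>u\<in>cart pt X. snd (dec (pt \<times> X) u))),
        Runit = (\<lambda>X. Arrow (cart X pt) X (\<lambda>u\<in>cart X pt. fst (dec (X \<times> pt) u))),
        Braid = (\<lambda>X Y. code_map (X \<times> Y) (Y \<times> X) prod.swap)\<rparr>)"

definition fun_sym :: "('o, 'a, 'x) cat_scheme \<Rightarrow> ('p, 'b, 'y) symcat_scheme \<Rightarrow>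
    (('o, 'a, 'p, 'b) fctr, (('o, 'a, 'p, 'b) fctr, 'o \<Rightarrow> 'b) arrow) symcat" where
  "fun_sym C D = (let
      tens = (\<lambda>F H. \<lparr>FOb = (\<lambda>x\<in>Ob C. FOb F x \<otimes>\<^bsub>D\<^esub> FOb H x), FAr = (\<lambda>f\<in>Ar C. FAr F f \<boxtimes>\<^bsub>D\<^esub> FAr H f)\<rparr>);
      one = \<lparr>FOb = (\<lambda>x\<in>Ob C. Unit D), FAr = (\<lambda>f\<in>Ar C. Ident D (Unit D))\<rparr>
    in \<lparr>Ob = Ob (fun_cat C D), Ar = Ar (fun_cat C D), Src = Src (fun_cat C D),
        Tgt = Tgt (fun_cat C D), Ident = Ident (fun_cat C D), Cmp = Cmp (fun_cat C D),
        TOb = tens,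
        TAr = (\<lambda>s t. Arrow (tens (src s) (src t)) (tens (tgt s) (tgt t))
          (\<lambda>x\<in>Ob C. body s x \<boxtimes>\<^bsub>D\<^esub> body t x)),
        Unit = one,
        Assoc = (\<lambda>F H K. Arrow (tens (tens F H) K) (tens F (tens H K))
          (\<lambda>x\<in>Ob C. Assoc D (FOb F x) (FOb H x) (FOb K x))),
        Lunit = (\<lambda>F. Arrow (tens one F) F (\<lambda>x\<in>Ob C. Lunit D (FOb F x))),
        Runit = (\<lambda>F. Arrow (tens F one) F (\<lambda>x\<in>Ob C. Runit D (FOb F x))),
        Braid = (\<lambda>F H. Arrow (tens F H) (tens H F) (\<lambda>x\<in>Ob C. Braid D (FOb F x) (FOb H x)))\<rparr>)"

type_synonym 'u gset = "('u, 'u, 'u set, ('u set, 'u \<Rightarrow> 'u) arrow) fctr"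

definition gset_sym :: "('u, 'u) cat \<Rightarrow> ('u gset, ('u gset, 'u \<Rightarrow> ('u set, 'u \<Rightarrow> 'u) arrow) arrow) symcat"
  where "gset_sym G = fun_sym G set_sym"

end

theory Submission
  imports Defs
begin

text \<open>
  Write \<open>1\<close> for the terminal G-set and \<open>P\<close> for the representable G-set \<open>Hom(g, -)\<close>. The map \<open>\<chi> 1\<close> is
  invertible because \<open>\<chi>\<close> respects the unit isomorphisms, and \<open>\<chi>\<close> is invertible at every constant
  G-set \<open>S\<close> because \<open>S\<close> is a coproduct of copies of \<open>1\<close>. Two facts take this to an arbitrary \<open>F\<close>.

  First, \<open>F\<close> becomes constant after multiplication with \<open>P\<close>: since \<open>G\<close> is a groupoid,
  \<open>(v, h) \<mapsto> (h\<^sup>-\<^sup>1 v, h)\<close> is an isomorphism from \<open>F \<times> P\<close> to \<open>F(g) \<times> P\<close> over \<open>P\<close>. Naturality of \<open>\<chi>\<close>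
  alone gives from it that \<open>\<chi> F \<otimes> \<chi> P\<close> is as good as \<open>\<chi> S \<otimes> \<chi> P\<close> for \<open>S = F(g)\<close>, which is of no
  use while \<open>\<chi> P\<close> is unknown. What has to be shown is that \<open>\<chi> F \<otimes> \<alpha> P\<close> is invertible, so the
  isomorphism must act on \<open>\<beta> F \<otimes> \<alpha> P\<close>, an object that is not in the image of \<open>\<alpha>\<close> or \<open>\<beta>\<close>. It does,
  because of the diagonal of \<open>P\<close>: an isomorphism over \<open>P\<close> is an isomorphism in the coKleisli category
  of the comonad \<open>- \<otimes> P\<close>, and a map \<open>k : F \<otimes> P \<rightarrow> F'\<close> of that category is sent to
    \<open>\<beta> F \<otimes> \<alpha> P \<rightarrow> \<beta> F \<otimes> \<beta> P \<cong> \<beta> (F \<otimes> P) \<rightarrow> \<beta> F'\<close>,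
  a coKleisli map for the comonad \<open>- \<otimes> \<alpha> P\<close>. This assignment is functorial
  (\<open>transfer_comp\<close>, \<open>transfer_counit\<close>). The same construction for the identity transformation of \<open>\<alpha>\<close>
  replaces \<open>\<beta> F\<close> by \<open>\<alpha> F\<close>, and \<open>\<chi> - \<otimes> \<alpha> P\<close> commutes with the two. Hence \<open>\<chi> F \<otimes> \<alpha> P\<close> is
  isomorphic, as an arrow, to the invertible \<open>\<chi> S \<otimes> \<alpha> P\<close> (\<open>tensor_iso_of_coKleisli_iso\<close>).

  Second, the representables cover \<open>1\<close>: it is the colimit of \<open>g \<mapsto> Hom(g, -)\<close> over the opposite of \<open>G\<close>.
  Since \<open>\<alpha>\<close> and the tensor product of \<open>A\<close> preserve colimits, \<open>\<chi> F \<otimes> \<alpha> 1\<close> is a colimit of the arrows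
  \<open>\<chi> F \<otimes> \<alpha> P\<close> and therefore invertible, and \<open>\<alpha> 1\<close> is isomorphic to the unit of \<open>A\<close> (\<open>component_iso\<close>).
  Finally the inverses of the components of \<open>\<chi>\<close> form a monoidal transformation.
\<close>

section \<open>Isomorphisms and colimits\<close>

lemma mem_Hom: "f \<in> Hom C x y \<longleftrightarrow> f \<in> Ar C \<and> Src C f = x \<and> Tgt C f = y"
  by (simp add: Hom_def)

definition inv_ar :: "('o, 'a, 'x) cat_scheme \<Rightarrow> 'a \<Rightarrow> 'a" where
  "inv_ar C f = (SOME g. g \<in> Hom C (Tgt C f) (Src C f) \<and>
     g \<cdot>\<^bsub>C\<^esub> f = Ident C (Src C f) \<and> f \<cdot>\<^bsub>C\<^esub> g = Ident C (Tgt C f))"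

lemma is_isoI:
  assumes "f \<in> Hom C x y" "g \<in> Hom C y x" "g \<cdot>\<^bsub>C\<^esub> f = Ident C x" "f \<cdot>\<^bsub>C\<^esub> g = Ident C y"
  shows "is_iso C f"
  using assms unfolding is_iso_def by (auto simp: mem_Hom)

text \<open>
  Typing conditions are stated through \<open>Src\<close> and \<open>Tgt\<close> instead of \<open>Hom\<close>: the side conditions of the
  rules below then contain no variable that is absent from the rewritten term, so that the simplifier
  composes, types and cancels arrows on its own.
\<close>

context category
begin

declare Src_in [simp] Tgt_in [simp]

lemma Ident_simps [simp]:
  assumes "x \<in> Ob C"
  shows "Ident C x \<in> Ar C" "Src C (Ident C x) = x" "Tgt C (Ident C x) = x"
  using Ident_in[OF assms] by (simp_all add: mem_Hom)

lemma Cmp_simps [simp]: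
  assumes "f \<in> Ar C" "g \<in> Ar C" "Src C g = Tgt C f"
  shows "g \<cdot> f \<in> Ar C" "Src C (g \<cdot> f) = Src C f" "Tgt C (g \<cdot> f) = Tgt C g"
  using Cmp_in[of f "Src C f" "Tgt C f" g "Tgt C g"] assms by (simp_all add: mem_Hom)

lemma Cmp_unit [simp]:
  assumes "f \<in> Ar C"
  shows "Src C f = x \<Longrightarrow> f \<cdot> Ident C x = f" "Tgt C f = x \<Longrightarrow> Ident C x \<cdot> f = f"
  using Cmp_Ident_right[of f x "Tgt C f"] Cmp_Ident_left[of f "Src C f" x] assms
  unfolding mem_Hom by simp_all

lemma Cmp_assoc_right [simp]:
  assumes "f \<in> Ar C" "g \<in> Ar C" "h \<in> Ar C" "Src C g = Tgt C f" "Src C h = Tgt C g"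
  shows "(h \<cdot> g) \<cdot> f = h \<cdot> (g \<cdot> f)"
  using Cmp_assoc[of f "Src C f" "Tgt C f" g "Tgt C g" h "Tgt C h"] assms by (simp add: mem_Hom)

lemma
  assumes "is_iso C f"
  shows iso_Ar [simp]: "f \<in> Ar C"
    and inv_ar_Ar [simp]: "inv_ar C f \<in> Ar C"
    and Src_inv_ar [simp]: "Src C (inv_ar C f) = Tgt C f"
    and Tgt_inv_ar [simp]: "Tgt C (inv_ar C f) = Src C f"
    and inv_ar_left [simp]: "inv_ar C f \<cdot> f = Ident C (Src C f)"
    and inv_ar_right [simp]: "f \<cdot> inv_ar C f = Ident C (Tgt C f)"
proof -
  have ex: "\<exists>g. g \<in> Hom C (Tgt C f) (Src C f) \<and>
      g \<cdot> f = Ident C (Src C f) \<and> f \<cdot> g = Ident C (Tgt C f)"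
    using assms by (auto simp: is_iso_def)
  show "f \<in> Ar C" using assms by (simp add: is_iso_def)
  show "inv_ar C f \<in> Ar C" "Src C (inv_ar C f) = Tgt C f" "Tgt C (inv_ar C f) = Src C f"
    "inv_ar C f \<cdot> f = Ident C (Src C f)" "f \<cdot> inv_ar C f = Ident C (Tgt C f)"
    using someI_ex[OF ex] unfolding inv_ar_def[symmetric] by (simp_all add: mem_Hom)
qed

lemma inv_ar_cancel [simp]:
  assumes "is_iso C f" "k \<in> Ar C"
  shows "Tgt C k = Src C f \<Longrightarrow> inv_ar C f \<cdot> (f \<cdot> k) = k"
    and "Tgt C k = Tgt C f \<Longrightarrow> f \<cdot> (inv_ar C f \<cdot> k) = k"
proof -
  show "inv_ar C f \<cdot> (f \<cdot> k) = k" if "Tgt C k = Src C f"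
    by (subst Cmp_assoc_right[symmetric]) (use assms that in simp_all)
  show "f \<cdot> (inv_ar C f \<cdot> k) = k" if "Tgt C k = Tgt C f"
    by (subst Cmp_assoc_right[symmetric]) (use assms that in simp_all)
qed

lemma iso_inv_ar [simp]: "is_iso C f \<Longrightarrow> is_iso C (inv_ar C f)"
  by (rule is_isoI[of _ _ "Tgt C f" "Src C f" f]) (simp_all add: mem_Hom)

lemma iso_Ident [simp]: "x \<in> Ob C \<Longrightarrow> is_iso C (Ident C x)"
  by (rule is_isoI[of _ _ x x "Ident C x"]) (simp_all add: mem_Hom)

lemma iso_Cmp:
  assumes "is_iso C f" "is_iso C g" "Src C g = Tgt C f"
  shows "is_iso C (g \<cdot> f)"
  by (rule is_isoI[of _ _ "Src C f" "Tgt C g" "inv_ar C f \<cdot> inv_ar C g"])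
    (use assms in \<open>simp_all add: mem_Hom\<close>)

lemma iso_left_cancel:
  assumes "is_iso C f" "g \<in> Ar C" "h \<in> Ar C" "Tgt C g = Src C f" "Tgt C h = Src C f" "f \<cdot> g = f \<cdot> h"
  shows "g = h"
  using assms inv_ar_cancel(1)[of f g] inv_ar_cancel(1)[of f h] by metis

lemma iso_right_cancel:
  assumes "is_iso C f" "g \<in> Ar C" "h \<in> Ar C" "Src C g = Tgt C f" "Src C h = Tgt C f" "g \<cdot> f = h \<cdot> f"
  shows "g = h"
proof -
  have "g = (g \<cdot> f) \<cdot> inv_ar C f" using assms(1-5) by simp
  also have "\<dots> = h" unfolding assms(6) using assms(1-5) by simp
  finally show ?thesis .
qed

end

context is_functor
begin

lemma FOb_Ob [simp]: "x \<in> Ob C \<Longrightarrow> FOb F x \<in> Ob D"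
  by (rule FOb_in)

lemma FAr_simps [simp]:
  assumes "f \<in> Ar C"
  shows "FAr F f \<in> Ar D" "Src D (FAr F f) = FOb F (Src C f)" "Tgt D (FAr F f) = FOb F (Tgt C f)"
  using FAr_in[of f "Src C f" "Tgt C f"] assms by (simp_all add: mem_Hom)

declare FAr_Ident [simp]

lemma FAr_comp:
  assumes "f \<in> Ar C" "g \<in> Ar C" "Src C g = Tgt C f"
  shows "FAr F (g \<cdot>\<^bsub>C\<^esub> f) = FAr F g \<cdot>\<^bsub>D\<^esub> FAr F f"
  using FAr_Cmp[of f "Src C f" "Tgt C f" g "Tgt C g"] assms by (simp add: mem_Hom)

end

context nat_trans
begin

lemma component_simps [simp]:
  assumes "x \<in> Ob C"
  shows "\<tau> x \<in> Ar D" "Src D (\<tau> x) = FOb F x" "Tgt D (\<tau> x) = FOb H x"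
  using component_in[OF assms] by (simp_all add: mem_Hom)

lemma naturality:
  assumes "f \<in> Ar C" "Src C f = x" "Tgt C f = y"
  shows "\<tau> y \<cdot>\<^bsub>D\<^esub> FAr F f = FAr H f \<cdot>\<^bsub>D\<^esub> \<tau> x"
  using natural[of f x y] assms by (simp add: mem_Hom)

end

lemma colimit_unique:
  assumes "colimit J C K c \<iota>" "category C" "h \<in> Hom C c d" "k \<in> Hom C c d"
    and "\<And>j. j \<in> Ob J \<Longrightarrow> h \<cdot>\<^bsub>C\<^esub> \<iota> j = k \<cdot>\<^bsub>C\<^esub> \<iota> j"
  shows "h = k"
proof -
  interpret category C by fact
  have co: "is_functor J C K" "c \<in> Ob C"
    and \<iota>: "\<And>j. j \<in> Ob J \<Longrightarrow> \<iota> j \<in> Hom C (FOb K j) c"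
    and nat: "\<And>k. k \<in> Ar J \<Longrightarrow> \<iota> (Tgt J k) \<cdot>\<^bsub>C\<^esub> FAr K k = \<iota> (Src J k)"
    using assms(1) by (auto simp: colimit_def cocone_def)
  interpret K: is_functor J C K by fact
  have "cocone J C K d (\<lambda>j. h \<cdot>\<^bsub>C\<^esub> \<iota> j)"
    unfolding cocone_def
  proof (intro conjI ballI)
    show "d \<in> Ob C" using assms(3) by (auto simp: mem_Hom)
    fix j assume "j \<in> Ob J" thus "h \<cdot>\<^bsub>C\<^esub> \<iota> j \<in> Hom C (FOb K j) d"
      using \<iota>[of j] assms(3) by (simp add: mem_Hom)
  next
    fix k assume k: "k \<in> Ar J"
    show "h \<cdot>\<^bsub>C\<^esub> \<iota> (Tgt J k) \<cdot>\<^bsub>C\<^esub> FAr K k = h \<cdot>\<^bsub>C\<^esub> \<iota> (Src J k)"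
      using k assms(3) \<iota>[of "Tgt J k"] nat[OF k] by (simp add: mem_Hom)
  qed (use co in simp)
  with assms(1) have "\<exists>!g. g \<in> Hom C c d \<and> (\<forall>j\<in>Ob J. g \<cdot>\<^bsub>C\<^esub> \<iota> j = h \<cdot>\<^bsub>C\<^esub> \<iota> j)"
    unfolding colimit_def by blast
  thus ?thesis using assms(3-5) by metis
qed

text \<open>
  The inverse of \<open>h\<close> is induced by the arrows \<open>\<iota> j \<cdot> (\<theta> j)\<^sup>-\<^sup>1\<close>, which form a cocone because \<open>\<theta>\<close> is
  natural.
\<close>

lemma colimit_iso:
  assumes C: "category C"
    and c: "colimit J C K c \<iota>" and c': "colimit J C K' c' \<iota>'"
    and h: "h \<in> Hom C c c'"
    and \<theta>: "\<And>j. j \<in> Ob J \<Longrightarrow> \<theta> j \<in> Hom C (FOb K j) (FOb K' j)" "\<And>j. j \<in> Ob J \<Longrightarrow> is_iso C (\<theta> j)"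
    and nat: "\<And>k. k \<in> Ar J \<Longrightarrow> \<theta> (Tgt J k) \<cdot>\<^bsub>C\<^esub> FAr K k = FAr K' k \<cdot>\<^bsub>C\<^esub> \<theta> (Src J k)"
    and h\<iota>: "\<And>j. j \<in> Ob J \<Longrightarrow> h \<cdot>\<^bsub>C\<^esub> \<iota> j = \<iota>' j \<cdot>\<^bsub>C\<^esub> \<theta> j"
  shows "is_iso C h"
proof -
  interpret category C by fact
  have co: "is_functor J C K" "c \<in> Ob C"
    and \<iota>: "\<And>j. j \<in> Ob J \<Longrightarrow> \<iota> j \<in> Hom C (FOb K j) c"
    and \<iota>n: "\<And>k. k \<in> Ar J \<Longrightarrow> \<iota> (Tgt J k) \<cdot>\<^bsub>C\<^esub> FAr K k = \<iota> (Src J k)"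
    using c by (auto simp: colimit_def cocone_def)
  have co': "is_functor J C K'" "c' \<in> Ob C"
    and \<iota>': "\<And>j. j \<in> Ob J \<Longrightarrow> \<iota>' j \<in> Hom C (FOb K' j) c'"
    using c' by (auto simp: colimit_def cocone_def)
  interpret K: is_functor J C K by fact
  interpret K': is_functor J C K' by fact
  define i where "i j = inv_ar C (\<theta> j)" for j
  have i: "i j \<in> Ar C" "Src C (i j) = FOb K' j" "Tgt C (i j) = FOb K j"
    "i j \<cdot>\<^bsub>C\<^esub> \<theta> j = Ident C (FOb K j)" "\<theta> j \<cdot>\<^bsub>C\<^esub> i j = Ident C (FOb K' j)" if "j \<in> Ob J" for j
    using \<theta>[OF that] by (simp_all add: i_def mem_Hom)
  have "cocone J C K' c (\<lambda>j. \<iota> j \<cdot>\<^bsub>C\<^esub> i j)"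
    unfolding cocone_def
  proof (intro conjI ballI)
    fix j assume "j \<in> Ob J" thus "\<iota> j \<cdot>\<^bsub>C\<^esub> i j \<in> Hom C (FOb K' j) c"
      using \<iota>[of j] i[of j] by (simp add: mem_Hom)
  next
    fix k assume k: "k \<in> Ar J"
    let ?s = "Src J k" and ?t = "Tgt J k"
    have st: "?s \<in> Ob J" "?t \<in> Ob J" using k by simp_all
    have "i ?t \<cdot>\<^bsub>C\<^esub> FAr K' k = i ?t \<cdot>\<^bsub>C\<^esub> ((FAr K' k \<cdot>\<^bsub>C\<^esub> \<theta> ?s) \<cdot>\<^bsub>C\<^esub> i ?s)"
      using k st i \<theta>(1)[of ?s] by (simp add: mem_Hom)
    also have "\<dots> = (i ?t \<cdot>\<^bsub>C\<^esub> \<theta> ?t) \<cdot>\<^bsub>C\<^esub> (FAr K k \<cdot>\<^bsub>C\<^esub> i ?s)"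
      unfolding nat[OF k, symmetric] using k st i(1-3) \<theta>(1)[of ?t] by (simp add: mem_Hom)
    also have "\<dots> = FAr K k \<cdot>\<^bsub>C\<^esub> i ?s"
      using k st i by simp
    finally have "(\<iota> ?t \<cdot>\<^bsub>C\<^esub> i ?t) \<cdot>\<^bsub>C\<^esub> FAr K' k = (\<iota> ?t \<cdot>\<^bsub>C\<^esub> FAr K k) \<cdot>\<^bsub>C\<^esub> i ?s"
      using k st i(1-3) \<iota>[of ?t] by (simp add: mem_Hom)
    thus "(\<iota> ?t \<cdot>\<^bsub>C\<^esub> i ?t) \<cdot>\<^bsub>C\<^esub> FAr K' k = \<iota> ?s \<cdot>\<^bsub>C\<^esub> i ?s"
      by (simp add: \<iota>n[OF k])
  qed (use co co' in simp_all)
  then obtain k where k: "k \<in> Hom C c' c" "\<And>j. j \<in> Ob J \<Longrightarrow> k \<cdot>\<^bsub>C\<^esub> \<iota>' j = \<iota> j \<cdot>\<^bsub>C\<^esub> i j"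
    using c' unfolding colimit_def by blast
  have 1: "k \<cdot>\<^bsub>C\<^esub> h = Ident C c"
  proof (rule colimit_unique[OF c C])
    fix j assume j: "j \<in> Ob J"
    have "(k \<cdot>\<^bsub>C\<^esub> h) \<cdot>\<^bsub>C\<^esub> \<iota> j = (k \<cdot>\<^bsub>C\<^esub> \<iota>' j) \<cdot>\<^bsub>C\<^esub> \<theta> j"
      using k(1) h h\<iota>[OF j] \<iota>[OF j] \<iota>'[OF j] \<theta>(1)[OF j] by (simp add: mem_Hom)
    also have "\<dots> = Ident C c \<cdot>\<^bsub>C\<^esub> \<iota> j"
      unfolding k(2)[OF j] using i[OF j] \<iota>[OF j] \<theta>(1)[OF j] by (simp add: mem_Hom)
    finally show "(k \<cdot>\<^bsub>C\<^esub> h) \<cdot>\<^bsub>C\<^esub> \<iota> j = Ident C c \<cdot>\<^bsub>C\<^esub> \<iota> j" .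
  qed (use k h co in \<open>simp_all add: mem_Hom\<close>)
  have 2: "h \<cdot>\<^bsub>C\<^esub> k = Ident C c'"
  proof (rule colimit_unique[OF c' C])
    fix j assume j: "j \<in> Ob J"
    have "(h \<cdot>\<^bsub>C\<^esub> k) \<cdot>\<^bsub>C\<^esub> \<iota>' j = (h \<cdot>\<^bsub>C\<^esub> \<iota> j) \<cdot>\<^bsub>C\<^esub> i j"
      using k(1) h k(2)[OF j] \<iota>[OF j] \<iota>'[OF j] i(1-3)[OF j] by (simp add: mem_Hom)
    also have "\<dots> = Ident C c' \<cdot>\<^bsub>C\<^esub> \<iota>' j"
      unfolding h\<iota>[OF j] using i[OF j] \<iota>'[OF j] \<theta>(1)[OF j] by (simp add: mem_Hom)
    finally show "(h \<cdot>\<^bsub>C\<^esub> k) \<cdot>\<^bsub>C\<^esub> \<iota>' j = Ident C c' \<cdot>\<^bsub>C\<^esub> \<iota>' j" .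
  qed (use k h co' in \<open>simp_all add: mem_Hom\<close>)
  show ?thesis by (rule is_isoI[OF h k(1) 1 2])
qed

lemma component_iso_at_colimit:
  fixes J :: "('u, 'u) cat" and K :: "('u, 'u, 'o, 'a) fctr"
  assumes nt: "nat_trans C D F H \<tau>"
    and F: "cocontinuous TYPE('u) C D F" and H: "cocontinuous TYPE('u) C D H"
    and J: "small_category J" and c: "colimit J C K c \<iota>"
    and iso: "\<And>j. j \<in> Ob J \<Longrightarrow> is_iso D (\<tau> (FOb K j))"
  shows "is_iso D (\<tau> c)"
proof -
  interpret nat_trans C D F H \<tau> by (rule nt)
  have K: "is_functor J C K" and [simp]: "c \<in> Ob C"
    and \<iota>: "\<And>j. j \<in> Ob J \<Longrightarrow> \<iota> j \<in> Hom C (FOb K j) c"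
    using c by (auto simp: colimit_def cocone_def)
  interpret K: is_functor J C K by (rule K)
  have "colimit J D (fctr_comp F K) (FOb F c) (\<lambda>j. FAr F (\<iota> j))"
    and "colimit J D (fctr_comp H K) (FOb H c) (\<lambda>j. FAr H (\<iota> j))"
    using F H J c by (simp_all add: cocontinuous_def preserves_colimits_def)
  then show ?thesis
  proof (rule colimit_iso[where \<theta> = "\<lambda>j. \<tau> (FOb K j)", rotated])
    fix k assume "k \<in> Ar J"
    thus "\<tau> (FOb K (Tgt J k)) \<cdot>\<^bsub>D\<^esub> FAr (fctr_comp F K) k =
        FAr (fctr_comp H K) k \<cdot>\<^bsub>D\<^esub> \<tau> (FOb K (Src J k))"
      by (simp add: fctr_comp_def naturality)
  next
    fix j assume "j \<in> Ob J"
    thus "\<tau> c \<cdot>\<^bsub>D\<^esub> FAr F (\<iota> j) = FAr H (\<iota> j) \<cdot>\<^bsub>D\<^esub> \<tau> (FOb K j)"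
      using \<iota>[of j] by (intro naturality) (simp_all add: mem_Hom)
  qed (use F iso in \<open>simp_all add: mem_Hom fctr_comp_def cocontinuous_def is_functor_def\<close>)
qed

section \<open>Monoidal categories and comonoids\<close>

context monoidal_category
begin

declare TOb_in [simp] Unit_in [simp] Assoc_iso [simp] Lunit_iso [simp] Runit_iso [simp]

lemma TAr_simps [simp]:
  assumes "f \<in> Ar C" "g \<in> Ar C"
  shows "f \<boxtimes> g \<in> Ar C" "Src C (f \<boxtimes> g) = Src C f \<otimes> Src C g" "Tgt C (f \<boxtimes> g) = Tgt C f \<otimes> Tgt C g"
  using TAr_in[of f "Src C f" "Tgt C f" g "Src C g" "Tgt C g"] assms by (simp_all add: mem_Hom)

declare TAr_Ident [simp]

lemma interchange:
  assumes "f \<in> Ar C" "g \<in> Ar C" "Src C g = Tgt C f" "f' \<in> Ar C" "g' \<in> Ar C" "Src C g' = Tgt C f'"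
  shows "(g \<boxtimes> g') \<cdot> (f \<boxtimes> f') = (g \<cdot> f) \<boxtimes> (g' \<cdot> f')"
  using TAr_Cmp[of f "Src C f" "Tgt C f" g "Tgt C g" f' "Src C f'" "Tgt C f'" g' "Tgt C g'"] assms
  by (simp add: mem_Hom)

lemma interchange_tail:
  assumes "f \<in> Ar C" "g \<in> Ar C" "Src C g = Tgt C f" "f' \<in> Ar C" "g' \<in> Ar C" "Src C g' = Tgt C f'"
    "k \<in> Ar C" "Tgt C k = Src C f \<otimes> Src C f'"
  shows "(g \<boxtimes> g') \<cdot> ((f \<boxtimes> f') \<cdot> k) = ((g \<cdot> f) \<boxtimes> (g' \<cdot> f')) \<cdot> k"
  using assms by (simp flip: interchange)

lemma structure_simps [simp]:
  shows "x \<in> Ob C \<Longrightarrow> y \<in> Ob C \<Longrightarrow> z \<in> Ob C \<Longrightarrow> Src C (Assoc C x y z) = x \<otimes> y \<otimes> z"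
    and "x \<in> Ob C \<Longrightarrow> y \<in> Ob C \<Longrightarrow> z \<in> Ob C \<Longrightarrow> Tgt C (Assoc C x y z) = x \<otimes> (y \<otimes> z)"
    and "x \<in> Ob C \<Longrightarrow> Src C (Lunit C x) = Unit C \<otimes> x"
    and "x \<in> Ob C \<Longrightarrow> Tgt C (Lunit C x) = x"
    and "x \<in> Ob C \<Longrightarrow> Src C (Runit C x) = x \<otimes> Unit C"
    and "x \<in> Ob C \<Longrightarrow> Tgt C (Runit C x) = x"
  using Assoc_in[of x y z] Lunit_in[of x] Runit_in[of x] by (simp_all add: mem_Hom)

lemma iso_TAr [simp]:
  assumes "is_iso C f" "is_iso C g"
  shows "is_iso C (f \<boxtimes> g)"
  by (rule is_isoI[of _ _ "Src C f \<otimes> Src C g" "Tgt C f \<otimes> Tgt C g" "inv_ar C f \<boxtimes> inv_ar C g"])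
    (use assms in \<open>simp_all add: mem_Hom interchange\<close>)

lemma Assoc_inv_natural:
  assumes "f \<in> Ar C" "Src C f = x" "Tgt C f = x'" "g \<in> Ar C" "Src C g = y" "Tgt C g = y'"
    "h \<in> Ar C" "Src C h = z" "Tgt C h = z'"
  shows "inv_ar C (Assoc C x' y' z') \<cdot> (f \<boxtimes> (g \<boxtimes> h)) = ((f \<boxtimes> g) \<boxtimes> h) \<cdot> inv_ar C (Assoc C x y z)"
proof (rule iso_left_cancel[of "Assoc C x' y' z'"])
  have *: "Assoc C x' y' z' \<cdot> ((f \<boxtimes> g) \<boxtimes> h) = (f \<boxtimes> (g \<boxtimes> h)) \<cdot> Assoc C x y z"
    using Assoc_natural[of f x x' g y y' h z z'] assms by (simp add: mem_Hom)
  have "Assoc C x' y' z' \<cdot> (((f \<boxtimes> g) \<boxtimes> h) \<cdot> inv_ar C (Assoc C x y z)) =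
      (Assoc C x' y' z' \<cdot> ((f \<boxtimes> g) \<boxtimes> h)) \<cdot> inv_ar C (Assoc C x y z)"
    using assms by auto
  also have "\<dots> = f \<boxtimes> (g \<boxtimes> h)" unfolding * using assms by auto
  finally show "Assoc C x' y' z' \<cdot> (inv_ar C (Assoc C x' y' z') \<cdot> (f \<boxtimes> (g \<boxtimes> h))) =
      Assoc C x' y' z' \<cdot> (((f \<boxtimes> g) \<boxtimes> h) \<cdot> inv_ar C (Assoc C x y z))" using assms by auto
qed (use assms in auto)

end

text \<open>
  Tensoring with the unit is isomorphic to the identity functor by the right unitor, and tensoring with
  \<open>v\<close> to tensoring with the unit by \<open>u\<close>.
\<close>

lemma (in monoidal_category) iso_of_tensor_iso:
  assumes [simp]: "f \<in> Ar C" and u: "is_iso C u" "Src C u = Unit C" "Tgt C u = v"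
    and fv: "is_iso C (f \<boxtimes> Ident C v)"
  shows "is_iso C f"
proof -
  let ?x = "Src C f" and ?y = "Tgt C f"
  have [simp]: "u \<in> Ar C" "v \<in> Ob C" using u Tgt_in[of u] by simp_all
  have "f = Runit C ?y \<cdot> ((f \<boxtimes> Ident C (Unit C)) \<cdot> inv_ar C (Runit C ?x))"
  proof -
    have "f = (f \<cdot> Runit C ?x) \<cdot> inv_ar C (Runit C ?x)" by simp
    also have "f \<cdot> Runit C ?x = Runit C ?y \<cdot> (f \<boxtimes> Ident C (Unit C))"
      by (rule Runit_natural[symmetric]) (simp add: mem_Hom)
    finally show ?thesis by simp
  qed
  also have "f \<boxtimes> Ident C (Unit C) =
      (Ident C ?y \<boxtimes> inv_ar C u) \<cdot> ((f \<boxtimes> Ident C v) \<cdot> (Ident C ?x \<boxtimes> u))"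
    using u by (simp add: interchange)
  also have "is_iso C (Runit C ?y \<cdot> (\<dots> \<cdot> inv_ar C (Runit C ?x)))"
    using u fv by (intro iso_Cmp) simp_all
  finally show ?thesis .
qed

definition left_counital_comonoid ::
  "('o, 'a, 'x) moncat_scheme \<Rightarrow> 'o \<Rightarrow> 'a \<Rightarrow> 'a \<Rightarrow> bool" where
  "left_counital_comonoid C c \<delta> \<epsilon> \<longleftrightarrow> c \<in> Ob C \<and>
     \<delta> \<in> Hom C c (c \<otimes>\<^bsub>C\<^esub> c) \<and> \<epsilon> \<in> Hom C c (Unit C) \<and>
     Assoc C c c c \<cdot>\<^bsub>C\<^esub> (\<delta> \<boxtimes>\<^bsub>C\<^esub> Ident C c) \<cdot>\<^bsub>C\<^esub> \<delta> = (Ident C c \<boxtimes>\<^bsub>C\<^esub> \<delta>) \<cdot>\<^bsub>C\<^esub> \<delta> \<and>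
     Lunit C c \<cdot>\<^bsub>C\<^esub> (\<epsilon> \<boxtimes>\<^bsub>C\<^esub> Ident C c) \<cdot>\<^bsub>C\<^esub> \<delta> = Ident C c"

text \<open>
  A comonoid \<open>c\<close> makes \<open>- \<otimes> c\<close> a comonad; its comultiplication and counit are \<open>cofree_comult\<close> and
  \<open>cofree_counit\<close>. For a coKleisli arrow \<open>f : x \<otimes> c \<rightarrow> y\<close>, \<open>coext\<close> is the induced map of cofree coalgebras
  \<open>x \<otimes> c \<rightarrow> y \<otimes> c\<close>, so that \<open>g \<cdot> coext f\<close> is composition in the coKleisli category.
\<close>

definition cofree_comult :: "('o, 'a, 'x) moncat_scheme \<Rightarrow> 'o \<Rightarrow> 'a \<Rightarrow> 'o \<Rightarrow> 'a" where
  "cofree_comult C c \<delta> x = inv_ar C (Assoc C x c c) \<cdot>\<^bsub>C\<^esub> (Ident C x \<boxtimes>\<^bsub>C\<^esub> \<delta>)"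

definition cofree_counit :: "('o, 'a, 'x) moncat_scheme \<Rightarrow> 'a \<Rightarrow> 'o \<Rightarrow> 'a" where
  "cofree_counit C \<epsilon> x = Runit C x \<cdot>\<^bsub>C\<^esub> (Ident C x \<boxtimes>\<^bsub>C\<^esub> \<epsilon>)"

definition coext :: "('o, 'a, 'x) moncat_scheme \<Rightarrow> 'o \<Rightarrow> 'a \<Rightarrow> 'o \<Rightarrow> 'a \<Rightarrow> 'a" where
  "coext C c \<delta> x f = (f \<boxtimes>\<^bsub>C\<^esub> Ident C c) \<cdot>\<^bsub>C\<^esub> cofree_comult C c \<delta> x"

locale comonoid_object = monoidal_category C for C :: "('o, 'a, 'x) moncat_scheme" (structure) +
  fixes c \<delta> \<epsilon>
  assumes comonoid: "left_counital_comonoid C c \<delta> \<epsilon>"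
begin

lemma comonoid_simps [simp]:
  "c \<in> Ob C" "\<delta> \<in> Ar C" "Src C \<delta> = c" "Tgt C \<delta> = c \<otimes> c" "\<epsilon> \<in> Ar C" "Src C \<epsilon> = c" "Tgt C \<epsilon> = Unit C"
  using comonoid by (simp_all add: left_counital_comonoid_def mem_Hom)

abbreviation "W \<equiv> cofree_comult C c \<delta>"

lemma cofree_comult_simps [simp]:
  assumes "x \<in> Ob C"
  shows "W x \<in> Ar C" "Src C (W x) = x \<otimes> c" "Tgt C (W x) = x \<otimes> c \<otimes> c"
  using assms by (simp_all add: cofree_comult_def)

lemma cofree_counit_simps [simp]:
  assumes "x \<in> Ob C"
  shows "cofree_counit C \<epsilon> x \<in> Ar C" "Src C (cofree_counit C \<epsilon> x) = x \<otimes> c"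
    "Tgt C (cofree_counit C \<epsilon> x) = x"
  using assms by (simp_all add: cofree_counit_def)

lemma coext_simps [simp]:
  assumes "x \<in> Ob C" "f \<in> Ar C" "Src C f = x \<otimes> c"
  shows "coext C c \<delta> x f \<in> Ar C" "Src C (coext C c \<delta> x f) = x \<otimes> c"
    "Tgt C (coext C c \<delta> x f) = Tgt C f \<otimes> c"
  using assms by (simp_all add: coext_def)

lemma coassoc: "\<delta> \<boxtimes> Ident C c \<cdot> \<delta> = inv_ar C (Assoc C c c c) \<cdot> (Ident C c \<boxtimes> \<delta> \<cdot> \<delta>)"
proof -
  have *: "Assoc C c c c \<cdot> (\<delta> \<boxtimes> Ident C c \<cdot> \<delta>) = Ident C c \<boxtimes> \<delta> \<cdot> \<delta>"
    using comonoid by (simp add: left_counital_comonoid_def)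
  show ?thesis unfolding *[symmetric] by simp
qed

lemma counit: "Lunit C c \<cdot> (\<epsilon> \<boxtimes> Ident C c \<cdot> \<delta>) = Ident C c"
  using comonoid by (simp add: left_counital_comonoid_def)

lemma cofree_comult_natural:
  assumes "f \<in> Ar C" "Src C f = x" "Tgt C f = y"
  shows "W y \<cdot> (f \<boxtimes> Ident C c) = ((f \<boxtimes> Ident C c) \<boxtimes> Ident C c) \<cdot> W x"
proof -
  have [simp]: "x \<in> Ob C" "y \<in> Ob C" using assms by auto
  have "W y \<cdot> (f \<boxtimes> Ident C c) = inv_ar C (Assoc C y c c) \<cdot> (f \<boxtimes> \<delta>)"
    using assms by (simp add: cofree_comult_def interchange)
  also have "f \<boxtimes> \<delta> = (f \<boxtimes> (Ident C c \<boxtimes> Ident C c)) \<cdot> (Ident C x \<boxtimes> \<delta>)"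
    using assms by (simp add: interchange)
  also have "inv_ar C (Assoc C y c c) \<cdot> \<dots> =
      (inv_ar C (Assoc C y c c) \<cdot> (f \<boxtimes> (Ident C c \<boxtimes> Ident C c))) \<cdot> (Ident C x \<boxtimes> \<delta>)"
    using assms by (simp del: TAr_Ident)
  also have "\<dots> = ((f \<boxtimes> Ident C c) \<boxtimes> Ident C c) \<cdot> W x"
    by (subst Assoc_inv_natural[of f x y _ c c _ c c])
      (use assms in \<open>simp_all add: cofree_comult_def\<close>)
  finally show ?thesis .
qed

lemma pentagon_inv:
  assumes [simp]: "w \<in> Ob C" "x \<in> Ob C" "y \<in> Ob C" "z \<in> Ob C"
  shows "inv_ar C (Assoc C (w \<otimes> x) y z) \<cdot> inv_ar C (Assoc C w x (y \<otimes> z)) =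
    (inv_ar C (Assoc C w x y) \<boxtimes> Ident C z) \<cdot>
      (inv_ar C (Assoc C w (x \<otimes> y) z) \<cdot> (Ident C w \<boxtimes> inv_ar C (Assoc C x y z)))"
    (is "?l = ?r")
proof (rule iso_right_cancel)
  let ?p = "Assoc C w x (y \<otimes> z) \<cdot> Assoc C (w \<otimes> x) y z"
  show "is_iso C ?p" by (rule iso_Cmp) simp_all
  have "?r \<cdot> ?p = ?r \<cdot> (Ident C w \<boxtimes> Assoc C x y z \<cdot> Assoc C w (x \<otimes> y) z \<cdot> (Assoc C w x y \<boxtimes> Ident C z))"
    unfolding pentagon[OF assms] ..
  also have "\<dots> = Ident C (w \<otimes> x \<otimes> y \<otimes> z)"
    by (simp add: interchange interchange_tail)
  finally show "?l \<cdot> ?p = ?r \<cdot> ?p" by simp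
qed simp_all

text \<open>
  The pentagon and naturality of the associator in the last two arguments reduce this to coassociativity
  of \<open>\<delta>\<close>, tensored with \<open>x\<close>.
\<close>

lemma cofree_comult_coassoc:
  assumes [simp]: "x \<in> Ob C"
  shows "W (x \<otimes> c) \<cdot> W x = (W x \<boxtimes> Ident C c) \<cdot> W x"
proof -
  let ?i = "Ident C" and ?b = "\<lambda>x y z. inv_ar C (Assoc C x y z)"
  have "W (x \<otimes> c) \<cdot> W x = ?b (x \<otimes> c) c c \<cdot> ((?i (x \<otimes> c) \<boxtimes> \<delta> \<cdot> ?b x c c) \<cdot> (?i x \<boxtimes> \<delta>))"
    by (simp add: cofree_comult_def)
  also have "?i (x \<otimes> c) \<boxtimes> \<delta> \<cdot> ?b x c c = ?b x c (c \<otimes> c) \<cdot> (?i x \<boxtimes> (?i c \<boxtimes> \<delta>))"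
    by (subst Assoc_inv_natural[of "?i x" x x "?i c" c c \<delta> c "c \<otimes> c"]) simp_all
  also have "?b (x \<otimes> c) c c \<cdot> (?b x c (c \<otimes> c) \<cdot> (?i x \<boxtimes> (?i c \<boxtimes> \<delta>)) \<cdot> (?i x \<boxtimes> \<delta>)) =
      (?b (x \<otimes> c) c c \<cdot> ?b x c (c \<otimes> c)) \<cdot> (?i x \<boxtimes> (?i c \<boxtimes> \<delta> \<cdot> \<delta>))"
    by (simp add: interchange)
  also have "\<dots> = (?b x c c \<boxtimes> ?i c) \<cdot> (?b x (c \<otimes> c) c \<cdot> (?i x \<boxtimes> (?b c c c \<cdot> (?i c \<boxtimes> \<delta> \<cdot> \<delta>))))"
    unfolding pentagon_inv[OF assms comonoid_simps(1,1,1)] by (simp add: interchange)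
  also have "?b c c c \<cdot> (?i c \<boxtimes> \<delta> \<cdot> \<delta>) = \<delta> \<boxtimes> ?i c \<cdot> \<delta>" by (rule coassoc[symmetric])
  also have "?b x (c \<otimes> c) c \<cdot> (?i x \<boxtimes> (\<delta> \<boxtimes> ?i c \<cdot> \<delta>)) =
      (?b x (c \<otimes> c) c \<cdot> (?i x \<boxtimes> (\<delta> \<boxtimes> ?i c))) \<cdot> (?i x \<boxtimes> \<delta>)"
    by (simp add: interchange)
  also have "\<dots> = ((?i x \<boxtimes> \<delta>) \<boxtimes> ?i c) \<cdot> ?b x c c \<cdot> (?i x \<boxtimes> \<delta>)"
    by (subst Assoc_inv_natural[of "?i x" x x \<delta> c "c \<otimes> c" "?i c" c c]) simp_all
  also have "(?b x c c \<boxtimes> ?i c) \<cdot> \<dots> = (W x \<boxtimes> ?i c) \<cdot> W x"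
    by (simp add: cofree_comult_def interchange_tail)
  finally show ?thesis .
qed

lemma coext_comp:
  assumes [simp]: "x \<in> Ob C" "f \<in> Ar C" "Src C f = x \<otimes> c" "Tgt C f = y"
    and [simp]: "g \<in> Ar C" "Src C g = y \<otimes> c"
  shows "coext C c \<delta> y g \<cdot> coext C c \<delta> x f = coext C c \<delta> x (g \<cdot> coext C c \<delta> x f)"
proof -
  have [simp]: "y \<in> Ob C" using Tgt_in[of f] by simp
  let ?i = "Ident C c"
  have "coext C c \<delta> y g \<cdot> coext C c \<delta> x f = (g \<boxtimes> ?i) \<cdot> ((W y \<cdot> (f \<boxtimes> ?i)) \<cdot> W x)"
    by (simp add: coext_def)
  also have "W y \<cdot> (f \<boxtimes> ?i) = ((f \<boxtimes> ?i) \<boxtimes> ?i) \<cdot> W (x \<otimes> c)"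
    by (rule cofree_comult_natural) simp_all
  also have "(g \<boxtimes> ?i) \<cdot> (((f \<boxtimes> ?i) \<boxtimes> ?i) \<cdot> W (x \<otimes> c) \<cdot> W x) =
      (g \<boxtimes> ?i) \<cdot> (((f \<boxtimes> ?i) \<boxtimes> ?i) \<cdot> (W (x \<otimes> c) \<cdot> W x))" by simp
  also have "\<dots> = coext C c \<delta> x (g \<cdot> coext C c \<delta> x f)"
    by (simp add: cofree_comult_coassoc coext_def interchange_tail)
  finally show ?thesis .
qed

lemma coext_precomp:
  assumes [simp]: "f \<in> Ar C" "Src C f = y \<otimes> c" "h \<in> Ar C" "Src C h = x" "Tgt C h = y"
  shows "coext C c \<delta> y f \<cdot> (h \<boxtimes> Ident C c) = coext C c \<delta> x (f \<cdot> (h \<boxtimes> Ident C c))"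
proof -
  have [simp]: "x \<in> Ob C" "y \<in> Ob C"
    using Src_in[of h] Tgt_in[of h] by simp_all
  have "coext C c \<delta> y f \<cdot> (h \<boxtimes> Ident C c) = (f \<boxtimes> Ident C c) \<cdot> (W y \<cdot> (h \<boxtimes> Ident C c))"
    by (simp add: coext_def)
  also have "\<dots> = coext C c \<delta> x (f \<cdot> (h \<boxtimes> Ident C c))"
    by (subst cofree_comult_natural[of h x y]) (simp_all add: coext_def interchange_tail)
  finally show ?thesis .
qed

lemma coext_postcomp:
  assumes [simp]: "x \<in> Ob C" "f \<in> Ar C" "Src C f = x \<otimes> c" "h \<in> Ar C" "Src C h = Tgt C f"
  shows "(h \<boxtimes> Ident C c) \<cdot> coext C c \<delta> x f = coext C c \<delta> x (h \<cdot> f)"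
  by (simp add: coext_def interchange_tail)

text \<open>
  The triangle identity turns the right unitor in \<open>cofree_counit\<close> into the left unitor that occurs in the
  left counit law.
\<close>

lemma coext_counit:
  assumes [simp]: "x \<in> Ob C"
  shows "coext C c \<delta> x (cofree_counit C \<epsilon> x) = Ident C (x \<otimes> c)"
proof -
  let ?i = "Ident C" and ?b = "\<lambda>y. inv_ar C (Assoc C x y c)"
  have tri: "Runit C x \<boxtimes> ?i c = (?i x \<boxtimes> Lunit C c) \<cdot> Assoc C x (Unit C) c"
    by (rule triangle[symmetric]) simp_all
  have "coext C c \<delta> x (cofree_counit C \<epsilon> x) =
      (Runit C x \<boxtimes> ?i c) \<cdot> ((((?i x \<boxtimes> \<epsilon>) \<boxtimes> ?i c) \<cdot> ?b c) \<cdot> (?i x \<boxtimes> \<delta>))"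
    by (simp add: coext_def cofree_counit_def cofree_comult_def interchange_tail)
  also have "((?i x \<boxtimes> \<epsilon>) \<boxtimes> ?i c) \<cdot> ?b c = ?b (Unit C) \<cdot> (?i x \<boxtimes> (\<epsilon> \<boxtimes> ?i c))"
    by (rule Assoc_inv_natural[symmetric]) simp_all
  also have "(Runit C x \<boxtimes> ?i c) \<cdot> (\<dots> \<cdot> (?i x \<boxtimes> \<delta>)) = ?i x \<boxtimes> (Lunit C c \<cdot> (\<epsilon> \<boxtimes> ?i c \<cdot> \<delta>))"
    unfolding tri by (simp add: interchange interchange_tail)
  also have "\<dots> = ?i (x \<otimes> c)" by (simp add: counit)
  finally show ?thesis .
qed

end

section \<open>Comonoids under monoidal functors and transformations\<close>

context monoidal_functor
begin

declare Mult_iso [simp] MUnit_iso [simp]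

lemma Mult_simps [simp]:
  assumes "x \<in> Ob C" "y \<in> Ob C"
  shows "Src D (Mult F x y) = FOb F x \<otimes>\<^bsub>D\<^esub> FOb F y" "Tgt D (Mult F x y) = FOb F (x \<otimes>\<^bsub>C\<^esub> y)"
  using Mult_in[OF assms] by (simp_all add: mem_Hom)

lemma MUnit_simps [simp]: "Src D (MUnit F) = Unit D" "Tgt D (MUnit F) = FOb F (Unit C)"
  using MUnit_in by (simp_all add: mem_Hom)

lemma Mult_nat_left:
  assumes "f \<in> Ar C" "Src C f = x" "Tgt C f = x'" "y \<in> Ob C"
  shows "Mult F x' y \<cdot>\<^bsub>D\<^esub> (FAr F f \<boxtimes>\<^bsub>D\<^esub> Ident D (FOb F y)) =
    FAr F (f \<boxtimes>\<^bsub>C\<^esub> Ident C y) \<cdot>\<^bsub>D\<^esub> Mult F x y"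
  using Mult_natural[of f x x' "Ident C y" y y] assms by (simp add: mem_Hom)

lemma Mult_nat_right:
  assumes "f \<in> Ar C" "Src C f = x" "Tgt C f = x'" "y \<in> Ob C"
  shows "Mult F y x' \<cdot>\<^bsub>D\<^esub> (Ident D (FOb F y) \<boxtimes>\<^bsub>D\<^esub> FAr F f) =
    FAr F (Ident C y \<boxtimes>\<^bsub>C\<^esub> f) \<cdot>\<^bsub>D\<^esub> Mult F y x"
  using Mult_natural[of "Ident C y" y y f x x'] assms by (simp add: mem_Hom)

definition image_comult :: "'o \<Rightarrow> 'a \<Rightarrow> 'b" where
  "image_comult c \<delta> = inv_ar D (Mult F c c) \<cdot>\<^bsub>D\<^esub> FAr F \<delta>"

definition image_counit :: "'a \<Rightarrow> 'b" where
  "image_counit \<epsilon> = inv_ar D (MUnit F) \<cdot>\<^bsub>D\<^esub> FAr F \<epsilon>"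

text \<open>
  Each law for the image is compared with the image of the law along an isomorphism made of
  multiplication and unit constraints of \<open>F\<close>; the coherence of these constraints with the associator and
  the left unitor does the rest.
\<close>

lemma image_comonoid:
  assumes "left_counital_comonoid C c \<delta> \<epsilon>"
  shows "left_counital_comonoid D (FOb F c) (image_comult c \<delta>) (image_counit \<epsilon>)"
proof -
  interpret c: comonoid_object C c \<delta> \<epsilon>
    by unfold_locales (rule assms)
  let ?F = "FAr F" and ?c = "FOb F c" and ?\<mu> = "Mult F" and ?i = "Ident D (FOb F c)"
  let ?d = "image_comult c \<delta>" and ?e = "image_counit \<epsilon>"
  have d [simp]: "?d \<in> Ar D" "Src D ?d = ?c" "Tgt D ?d = ?c \<otimes>\<^bsub>D\<^esub> ?c" and \<mu>d: "?\<mu> c c \<cdot>\<^bsub>D\<^esub> ?d = ?F \<delta>"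
    by (simp_all add: image_comult_def)
  have e [simp]: "?e \<in> Ar D" "Src D ?e = ?c" "Tgt D ?e = Unit D" and \<eta>e: "MUnit F \<cdot>\<^bsub>D\<^esub> ?e = ?F \<epsilon>"
    by (simp_all add: image_counit_def)
  have "Assoc D ?c ?c ?c \<cdot>\<^bsub>D\<^esub> (?d \<boxtimes>\<^bsub>D\<^esub> ?i \<cdot>\<^bsub>D\<^esub> ?d) = ?i \<boxtimes>\<^bsub>D\<^esub> ?d \<cdot>\<^bsub>D\<^esub> ?d"
  proof (rule D.iso_left_cancel)
    let ?m = "?\<mu> c (c \<otimes>\<^bsub>C\<^esub> c) \<cdot>\<^bsub>D\<^esub> (?i \<boxtimes>\<^bsub>D\<^esub> ?\<mu> c c)"
    show "is_iso D ?m" by (rule D.iso_Cmp) simp_all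
    have "?m \<cdot>\<^bsub>D\<^esub> (Assoc D ?c ?c ?c \<cdot>\<^bsub>D\<^esub> (?d \<boxtimes>\<^bsub>D\<^esub> ?i \<cdot>\<^bsub>D\<^esub> ?d)) =
        (?m \<cdot>\<^bsub>D\<^esub> Assoc D ?c ?c ?c) \<cdot>\<^bsub>D\<^esub> (?d \<boxtimes>\<^bsub>D\<^esub> ?i \<cdot>\<^bsub>D\<^esub> ?d)" by simp
    also have "\<dots> = ?F (Assoc C c c c) \<cdot>\<^bsub>D\<^esub> ((?\<mu> (c \<otimes>\<^bsub>C\<^esub> c) c \<cdot>\<^bsub>D\<^esub> (?F \<delta> \<boxtimes>\<^bsub>D\<^esub> ?i)) \<cdot>\<^bsub>D\<^esub> ?d)"
      unfolding Mult_Assoc[symmetric, OF c.comonoid_simps(1,1,1)] by (simp add: D.interchange_tail \<mu>d)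
    also have "\<dots> = ?F (Assoc C c c c) \<cdot>\<^bsub>D\<^esub> (?F (\<delta> \<boxtimes>\<^bsub>C\<^esub> Ident C c) \<cdot>\<^bsub>D\<^esub> (?\<mu> c c \<cdot>\<^bsub>D\<^esub> ?d))"
      by (subst Mult_nat_left[of \<delta> c]) simp_all
    also have "\<dots> = ?F (Assoc C c c c \<cdot>\<^bsub>C\<^esub> (\<delta> \<boxtimes>\<^bsub>C\<^esub> Ident C c \<cdot>\<^bsub>C\<^esub> \<delta>))"
      unfolding \<mu>d by (simp add: FAr_comp)
    also have "Assoc C c c c \<cdot>\<^bsub>C\<^esub> (\<delta> \<boxtimes>\<^bsub>C\<^esub> Ident C c \<cdot>\<^bsub>C\<^esub> \<delta>) = Ident C c \<boxtimes>\<^bsub>C\<^esub> \<delta> \<cdot>\<^bsub>C\<^esub> \<delta>"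
      by (simp add: c.coassoc)
    also have "?F \<dots> = (?F (Ident C c \<boxtimes>\<^bsub>C\<^esub> \<delta>) \<cdot>\<^bsub>D\<^esub> ?\<mu> c c) \<cdot>\<^bsub>D\<^esub> ?d"
      by (simp add: FAr_comp \<mu>d)
    also have "\<dots> = ?\<mu> c (c \<otimes>\<^bsub>C\<^esub> c) \<cdot>\<^bsub>D\<^esub> (?i \<boxtimes>\<^bsub>D\<^esub> ?F \<delta>) \<cdot>\<^bsub>D\<^esub> ?d"
      by (subst Mult_nat_right[of \<delta> c]) simp_all
    also have "\<dots> = ?m \<cdot>\<^bsub>D\<^esub> (?i \<boxtimes>\<^bsub>D\<^esub> ?d \<cdot>\<^bsub>D\<^esub> ?d)"
      by (simp add: D.interchange_tail \<mu>d)
    finally show "?m \<cdot>\<^bsub>D\<^esub> (Assoc D ?c ?c ?c \<cdot>\<^bsub>D\<^esub> (?d \<boxtimes>\<^bsub>D\<^esub> ?i \<cdot>\<^bsub>D\<^esub> ?d)) =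
        ?m \<cdot>\<^bsub>D\<^esub> (?i \<boxtimes>\<^bsub>D\<^esub> ?d \<cdot>\<^bsub>D\<^esub> ?d)" .
  qed simp_all
  moreover have "Lunit D ?c \<cdot>\<^bsub>D\<^esub> (?e \<boxtimes>\<^bsub>D\<^esub> ?i \<cdot>\<^bsub>D\<^esub> ?d) = ?i"
  proof -
    have "Lunit D ?c \<cdot>\<^bsub>D\<^esub> (?e \<boxtimes>\<^bsub>D\<^esub> ?i \<cdot>\<^bsub>D\<^esub> ?d) =
        ?F (Lunit C c) \<cdot>\<^bsub>D\<^esub> ((?\<mu> (Unit C) c \<cdot>\<^bsub>D\<^esub> (?F \<epsilon> \<boxtimes>\<^bsub>D\<^esub> ?i)) \<cdot>\<^bsub>D\<^esub> ?d)"
      unfolding Mult_Lunit[symmetric, OF c.comonoid_simps(1)] by (simp add: D.interchange_tail \<eta>e)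
    also have "\<dots> = ?F (Lunit C c) \<cdot>\<^bsub>D\<^esub> (?F (\<epsilon> \<boxtimes>\<^bsub>C\<^esub> Ident C c) \<cdot>\<^bsub>D\<^esub> (?\<mu> c c \<cdot>\<^bsub>D\<^esub> ?d))"
      by (subst Mult_nat_left[of \<epsilon> c]) simp_all
    also have "\<dots> = ?F (Lunit C c \<cdot>\<^bsub>C\<^esub> (\<epsilon> \<boxtimes>\<^bsub>C\<^esub> Ident C c \<cdot>\<^bsub>C\<^esub> \<delta>))"
      unfolding \<mu>d by (simp add: FAr_comp)
    finally show ?thesis by (simp add: c.counit)
  qed
  ultimately show ?thesis
    by (simp add: left_counital_comonoid_def mem_Hom)
qed

end

context monoidal_nat_trans
begin

lemma component_comp_Mult:
  assumes "x \<in> Ob C" "y \<in> Ob C"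
  shows "\<tau> (x \<otimes>\<^bsub>C\<^esub> y) \<cdot>\<^bsub>D\<^esub> Mult F x y = Mult H x y \<cdot>\<^bsub>D\<^esub> (\<tau> x \<boxtimes>\<^bsub>D\<^esub> \<tau> y)"
  using component_Mult assms by simp

lemma Unit_iso: "is_iso D (\<tau> (Unit C))"
proof -
  have "\<tau> (Unit C) = (\<tau> (Unit C) \<cdot>\<^bsub>D\<^esub> MUnit F) \<cdot>\<^bsub>D\<^esub> inv_ar D (MUnit F)" by simp
  also have "\<dots> = MUnit H \<cdot>\<^bsub>D\<^esub> inv_ar D (MUnit F)" unfolding component_Unit ..
  finally show ?thesis by (simp add: F.D.iso_Cmp)
qed

end

lemma (in monoidal_nat_trans) inverse_transformation:
  assumes iso: "\<And>x. x \<in> Ob C \<Longrightarrow> is_iso D (\<tau> x)"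
  shows "monoidal_nat_trans C D H F (\<lambda>x. inv_ar D (\<tau> x))"
proof unfold_locales
  note [simp] = iso
  fix f x y assume f: "f \<in> Hom C x y"
  hence [simp]: "f \<in> Ar C" "Src C f = x" "Tgt C f = y" "x \<in> Ob C" "y \<in> Ob C"
    by (auto simp: mem_Hom)
  show "inv_ar D (\<tau> y) \<cdot>\<^bsub>D\<^esub> FAr H f = FAr F f \<cdot>\<^bsub>D\<^esub> inv_ar D (\<tau> x)"
  proof (rule F.D.iso_right_cancel[of "\<tau> x"])
    have "(inv_ar D (\<tau> y) \<cdot>\<^bsub>D\<^esub> FAr H f) \<cdot>\<^bsub>D\<^esub> \<tau> x = inv_ar D (\<tau> y) \<cdot>\<^bsub>D\<^esub> (\<tau> y \<cdot>\<^bsub>D\<^esub> FAr F f)"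
      by (simp add: naturality[of f x y])
    also have "\<dots> = (FAr F f \<cdot>\<^bsub>D\<^esub> inv_ar D (\<tau> x)) \<cdot>\<^bsub>D\<^esub> \<tau> x" by simp
    finally show "(inv_ar D (\<tau> y) \<cdot>\<^bsub>D\<^esub> FAr H f) \<cdot>\<^bsub>D\<^esub> \<tau> x =
      (FAr F f \<cdot>\<^bsub>D\<^esub> inv_ar D (\<tau> x)) \<cdot>\<^bsub>D\<^esub> \<tau> x" .
  qed simp_all
next
  note [simp] = iso
  fix x y assume [simp]: "x \<in> Ob C" "y \<in> Ob C"
  let ?t = "\<tau> x \<boxtimes>\<^bsub>D\<^esub> \<tau> y" and ?s = "inv_ar D (\<tau> x) \<boxtimes>\<^bsub>D\<^esub> inv_ar D (\<tau> y)"
  show "inv_ar D (\<tau> (x \<otimes>\<^bsub>C\<^esub> y)) \<cdot>\<^bsub>D\<^esub> Mult H x y = Mult F x y \<cdot>\<^bsub>D\<^esub> ?s"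
  proof (rule F.D.iso_right_cancel[of ?t])
    have "(inv_ar D (\<tau> (x \<otimes>\<^bsub>C\<^esub> y)) \<cdot>\<^bsub>D\<^esub> Mult H x y) \<cdot>\<^bsub>D\<^esub> ?t =
        inv_ar D (\<tau> (x \<otimes>\<^bsub>C\<^esub> y)) \<cdot>\<^bsub>D\<^esub> (\<tau> (x \<otimes>\<^bsub>C\<^esub> y) \<cdot>\<^bsub>D\<^esub> Mult F x y)"
      by (simp add: component_comp_Mult)
    also have "\<dots> = (Mult F x y \<cdot>\<^bsub>D\<^esub> ?s) \<cdot>\<^bsub>D\<^esub> ?t" by (simp add: F.D.interchange)
    finally show "(inv_ar D (\<tau> (x \<otimes>\<^bsub>C\<^esub> y)) \<cdot>\<^bsub>D\<^esub> Mult H x y) \<cdot>\<^bsub>D\<^esub> ?t =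
      (Mult F x y \<cdot>\<^bsub>D\<^esub> ?s) \<cdot>\<^bsub>D\<^esub> ?t" .
  qed simp_all
next
  show "inv_ar D (\<tau> (Unit C)) \<cdot>\<^bsub>D\<^esub> MUnit H = MUnit F"
    unfolding component_Unit[symmetric] using iso by simp
qed (simp_all add: mem_Hom iso)

text \<open>
  With the identity transformation, what is proved below for \<open>\<tau> : F \<Rightarrow> H\<close> also applies to \<open>F \<Rightarrow> F\<close>.
\<close>

lemma (in monoidal_functor) identity_transformation:
  "monoidal_nat_trans C D F F (\<lambda>x. Ident D (FOb F x))"
proof unfold_locales
  fix f x y assume "f \<in> Hom C x y"
  thus "Ident D (FOb F y) \<cdot>\<^bsub>D\<^esub> FAr F f = FAr F f \<cdot>\<^bsub>D\<^esub> Ident D (FOb F x)"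
    by (auto simp: mem_Hom)
qed (simp_all add: mem_Hom)

locale comonoid_transformation = monoidal_nat_trans C D F H \<tau>
  for C :: "('o, 'a, 'x) moncat_scheme" and D :: "('p, 'b, 'y) moncat_scheme"
    and F :: "('o, 'a, 'p, 'b, 'z) monfctr_scheme" and H :: "('o, 'a, 'p, 'b, 'w) monfctr_scheme"
    and \<tau> +
  fixes c \<delta> \<epsilon>
  assumes comonoid: "left_counital_comonoid C c \<delta> \<epsilon>"
begin

sublocale c: comonoid_object C c \<delta> \<epsilon>
  by unfold_locales (rule comonoid)

sublocale Fc: comonoid_object D "FOb F c" "F.image_comult c \<delta>" "F.image_counit \<epsilon>"
  by unfold_locales (rule F.image_comonoid[OF comonoid])

sublocale Hc: comonoid_object D "FOb H c" "H.image_comult c \<delta>" "H.image_counit \<epsilon>"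
  by unfold_locales (rule H.image_comonoid[OF comonoid])

text \<open>
  A coKleisli arrow \<open>k : x \<otimes> c \<rightarrow> y\<close> of \<open>C\<close> becomes a coKleisli arrow \<open>H x \<otimes> F c \<rightarrow> H y\<close> of \<open>D\<close>, with \<open>\<tau>\<close>
  used on the comonoid only. The lemmas below make this a functor from the coKleisli category of \<open>- \<otimes> c\<close>
  to that of \<open>- \<otimes> F c\<close>.
\<close>

definition transfer :: "'o \<Rightarrow> 'a \<Rightarrow> 'b" where
  "transfer x k = FAr H k \<cdot>\<^bsub>D\<^esub> Mult H x c \<cdot>\<^bsub>D\<^esub> (Ident D (FOb H x) \<boxtimes>\<^bsub>D\<^esub> \<tau> c)"

lemma transfer_simps [simp]:
  assumes "x \<in> Ob C" "k \<in> Ar C" "Src C k = x \<otimes>\<^bsub>C\<^esub> c"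
  shows "transfer x k \<in> Ar D" "Src D (transfer x k) = FOb H x \<otimes>\<^bsub>D\<^esub> FOb F c"
    "Tgt D (transfer x k) = FOb H (Tgt C k)"
  using assms by (simp_all add: transfer_def)

text \<open>
  This follows from naturality at \<open>\<delta>\<close> and monoidality, and is what allows \<open>\<tau>\<close> to be applied before or
  after copying the comonoid.
\<close>

lemma transformation_comult:
  "(\<tau> c \<boxtimes>\<^bsub>D\<^esub> \<tau> c) \<cdot>\<^bsub>D\<^esub> F.image_comult c \<delta> = H.image_comult c \<delta> \<cdot>\<^bsub>D\<^esub> \<tau> c"
proof (rule F.D.iso_left_cancel[of "Mult H c c"])
  let ?d = "F.image_comult c \<delta>"
  have "Mult H c c \<cdot>\<^bsub>D\<^esub> (\<tau> c \<boxtimes>\<^bsub>D\<^esub> \<tau> c \<cdot>\<^bsub>D\<^esub> ?d) = (Mult H c c \<cdot>\<^bsub>D\<^esub> (\<tau> c \<boxtimes>\<^bsub>D\<^esub> \<tau> c)) \<cdot>\<^bsub>D\<^esub> ?d"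
    by simp
  also have "\<dots> = \<tau> (c \<otimes>\<^bsub>C\<^esub> c) \<cdot>\<^bsub>D\<^esub> FAr F \<delta>"
    by (subst component_comp_Mult[symmetric]) (simp_all add: F.image_comult_def)
  also have "\<dots> = FAr H \<delta> \<cdot>\<^bsub>D\<^esub> \<tau> c"
    by (rule naturality) simp_all
  finally show "Mult H c c \<cdot>\<^bsub>D\<^esub> (\<tau> c \<boxtimes>\<^bsub>D\<^esub> \<tau> c \<cdot>\<^bsub>D\<^esub> ?d) =
      Mult H c c \<cdot>\<^bsub>D\<^esub> (H.image_comult c \<delta> \<cdot>\<^bsub>D\<^esub> \<tau> c)"
    by (simp add: H.image_comult_def)
qed simp_all

lemma cofree_comult_transformation:
  assumes [simp]: "X \<in> Ob D"
  shows "((Ident D X \<boxtimes>\<^bsub>D\<^esub> \<tau> c) \<boxtimes>\<^bsub>D\<^esub> \<tau> c) \<cdot>\<^bsub>D\<^esub> Fc.W X = Hc.W X \<cdot>\<^bsub>D\<^esub> (Ident D X \<boxtimes>\<^bsub>D\<^esub> \<tau> c)"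
proof -
  let ?i = "Ident D X" and ?t = "\<tau> c"
  have "((?i \<boxtimes>\<^bsub>D\<^esub> ?t) \<boxtimes>\<^bsub>D\<^esub> ?t) \<cdot>\<^bsub>D\<^esub> Fc.W X =
      (((?i \<boxtimes>\<^bsub>D\<^esub> ?t) \<boxtimes>\<^bsub>D\<^esub> ?t) \<cdot>\<^bsub>D\<^esub> inv_ar D (Assoc D X (FOb F c) (FOb F c))) \<cdot>\<^bsub>D\<^esub>
        (?i \<boxtimes>\<^bsub>D\<^esub> F.image_comult c \<delta>)"
    by (simp add: cofree_comult_def)
  also have "((?i \<boxtimes>\<^bsub>D\<^esub> ?t) \<boxtimes>\<^bsub>D\<^esub> ?t) \<cdot>\<^bsub>D\<^esub> inv_ar D (Assoc D X (FOb F c) (FOb F c)) =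
      inv_ar D (Assoc D X (FOb H c) (FOb H c)) \<cdot>\<^bsub>D\<^esub> (?i \<boxtimes>\<^bsub>D\<^esub> (?t \<boxtimes>\<^bsub>D\<^esub> ?t))"
    by (rule F.D.Assoc_inv_natural[symmetric]) simp_all
  also have "\<dots> \<cdot>\<^bsub>D\<^esub> (?i \<boxtimes>\<^bsub>D\<^esub> F.image_comult c \<delta>) = Hc.W X \<cdot>\<^bsub>D\<^esub> (?i \<boxtimes>\<^bsub>D\<^esub> ?t)"
    by (simp add: F.D.interchange transformation_comult cofree_comult_def)
  finally show ?thesis .
qed

text \<open>
  The multiplication constraint \<open>H x \<otimes> H c \<rightarrow> H (x \<otimes> c)\<close> makes \<open>H\<close> a morphism from the comonad
  \<open>- \<otimes> c\<close> to the comonad \<open>- \<otimes> H c\<close>, by its coherence with the associator.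
\<close>

lemma cofree_comult_image:
  assumes [simp]: "x \<in> Ob C"
  shows "Mult H (x \<otimes>\<^bsub>C\<^esub> c) c \<cdot>\<^bsub>D\<^esub> ((Mult H x c \<boxtimes>\<^bsub>D\<^esub> Ident D (FOb H c)) \<cdot>\<^bsub>D\<^esub> Hc.W (FOb H x)) =
    FAr H (c.W x) \<cdot>\<^bsub>D\<^esub> Mult H x c"
proof (rule F.D.iso_left_cancel[of "FAr H (Assoc C x c c)"])
  let ?X = "FOb H x" and ?Y = "FOb H c" and ?d = "H.image_comult c \<delta>"
  let ?a = "Assoc C x c c"
  have "is_iso C ?a" by simp
  then show "is_iso D (FAr H ?a)"
    by (intro is_isoI[of _ _ "FOb H (Src C ?a)" "FOb H (Tgt C ?a)" "FAr H (inv_ar C ?a)"])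
      (simp_all add: mem_Hom flip: H.FAr_comp)
  have "FAr H ?a \<cdot>\<^bsub>D\<^esub> (Mult H (x \<otimes>\<^bsub>C\<^esub> c) c \<cdot>\<^bsub>D\<^esub> ((Mult H x c \<boxtimes>\<^bsub>D\<^esub> Ident D ?Y) \<cdot>\<^bsub>D\<^esub> Hc.W ?X)) =
      (FAr H ?a \<cdot>\<^bsub>D\<^esub> Mult H (x \<otimes>\<^bsub>C\<^esub> c) c \<cdot>\<^bsub>D\<^esub> (Mult H x c \<boxtimes>\<^bsub>D\<^esub> Ident D ?Y)) \<cdot>\<^bsub>D\<^esub> Hc.W ?X"
    by simp
  also have "\<dots> = Mult H x (c \<otimes>\<^bsub>C\<^esub> c) \<cdot>\<^bsub>D\<^esub> (Ident D ?X \<boxtimes>\<^bsub>D\<^esub> FAr H \<delta>)"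
    unfolding H.Mult_Assoc[OF assms c.comonoid_simps(1,1)]
    by (simp add: cofree_comult_def F.D.interchange H.image_comult_def)
  also have "\<dots> = FAr H (Ident C x \<boxtimes>\<^bsub>C\<^esub> \<delta>) \<cdot>\<^bsub>D\<^esub> Mult H x c"
    by (rule H.Mult_nat_right) simp_all
  also have "Ident C x \<boxtimes>\<^bsub>C\<^esub> \<delta> = ?a \<cdot>\<^bsub>C\<^esub> c.W x"
    by (simp add: cofree_comult_def)
  also have "FAr H \<dots> \<cdot>\<^bsub>D\<^esub> Mult H x c = FAr H ?a \<cdot>\<^bsub>D\<^esub> (FAr H (c.W x) \<cdot>\<^bsub>D\<^esub> Mult H x c)"
    by (subst H.FAr_comp) simp_all
  finally show "FAr H ?a \<cdot>\<^bsub>D\<^esub> (Mult H (x \<otimes>\<^bsub>C\<^esub> c) c \<cdot>\<^bsub>D\<^esub>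
        ((Mult H x c \<boxtimes>\<^bsub>D\<^esub> Ident D ?Y) \<cdot>\<^bsub>D\<^esub> Hc.W ?X)) =
      FAr H ?a \<cdot>\<^bsub>D\<^esub> (FAr H (c.W x) \<cdot>\<^bsub>D\<^esub> Mult H x c)" .
qed simp_all

abbreviation "ext X f \<equiv> coext D (FOb F c) (F.image_comult c \<delta>) X f"

text \<open>
  Copying \<open>F c\<close> and then applying \<open>\<tau>\<close> to both copies is applying \<open>\<tau>\<close> and copying \<open>H c\<close>; the copying of
  \<open>H c\<close> is the image under \<open>H\<close> of the copying of \<open>c\<close>, so that all of it can be moved inside \<open>H\<close>.
\<close>

lemma transfer_comp:
  assumes [simp]: "x \<in> Ob C" "l \<in> Ar C" "Src C l = x \<otimes>\<^bsub>C\<^esub> c" "Tgt C l = y"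
    "k \<in> Ar C" "Src C k = y \<otimes>\<^bsub>C\<^esub> c"
  shows "transfer y k \<cdot>\<^bsub>D\<^esub> ext (FOb H x) (transfer x l) = transfer x (k \<cdot>\<^bsub>C\<^esub> coext C c \<delta> x l)"
proof -
  have [simp]: "y \<in> Ob C" using F.C.Tgt_in[of l] by simp
  let ?i = "\<lambda>x. Ident D (FOb H x)" and ?\<mu> = "Mult H" and ?t = "\<tau> c"
  have "transfer y k \<cdot>\<^bsub>D\<^esub> ext (FOb H x) (transfer x l) =
      FAr H k \<cdot>\<^bsub>D\<^esub> (?\<mu> y c \<cdot>\<^bsub>D\<^esub> (((FAr H l \<cdot>\<^bsub>D\<^esub> (?\<mu> x c \<cdot>\<^bsub>D\<^esub> (?i x \<boxtimes>\<^bsub>D\<^esub> ?t))) \<boxtimes>\<^bsub>D\<^esub> ?t) \<cdot>\<^bsub>D\<^esub> Fc.W (FOb H x)))"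
    by (simp add: transfer_def coext_def F.D.interchange_tail)
  also have "(FAr H l \<cdot>\<^bsub>D\<^esub> (?\<mu> x c \<cdot>\<^bsub>D\<^esub> (?i x \<boxtimes>\<^bsub>D\<^esub> ?t))) \<boxtimes>\<^bsub>D\<^esub> ?t =
      (FAr H l \<boxtimes>\<^bsub>D\<^esub> ?i c) \<cdot>\<^bsub>D\<^esub> ((?\<mu> x c \<boxtimes>\<^bsub>D\<^esub> ?i c) \<cdot>\<^bsub>D\<^esub> ((?i x \<boxtimes>\<^bsub>D\<^esub> ?t) \<boxtimes>\<^bsub>D\<^esub> ?t))"
    by (simp add: F.D.interchange)
  also have "FAr H k \<cdot>\<^bsub>D\<^esub> (?\<mu> y c \<cdot>\<^bsub>D\<^esub> (\<dots> \<cdot>\<^bsub>D\<^esub> Fc.W (FOb H x))) =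
      FAr H k \<cdot>\<^bsub>D\<^esub> ((?\<mu> y c \<cdot>\<^bsub>D\<^esub> (FAr H l \<boxtimes>\<^bsub>D\<^esub> ?i c)) \<cdot>\<^bsub>D\<^esub>
        ((?\<mu> x c \<boxtimes>\<^bsub>D\<^esub> ?i c) \<cdot>\<^bsub>D\<^esub> (((?i x \<boxtimes>\<^bsub>D\<^esub> ?t) \<boxtimes>\<^bsub>D\<^esub> ?t) \<cdot>\<^bsub>D\<^esub> Fc.W (FOb H x))))"
    by simp
  also have "\<dots> = FAr H k \<cdot>\<^bsub>D\<^esub> ((FAr H (l \<boxtimes>\<^bsub>C\<^esub> Ident C c) \<cdot>\<^bsub>D\<^esub> ?\<mu> (x \<otimes>\<^bsub>C\<^esub> c) c) \<cdot>\<^bsub>D\<^esub>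
        ((?\<mu> x c \<boxtimes>\<^bsub>D\<^esub> ?i c) \<cdot>\<^bsub>D\<^esub> (Hc.W (FOb H x) \<cdot>\<^bsub>D\<^esub> (?i x \<boxtimes>\<^bsub>D\<^esub> ?t))))"
    unfolding cofree_comult_transformation[OF H.FOb_Ob[OF assms(1)]]
      H.Mult_nat_left[OF assms(2-4) c.comonoid_simps(1)] ..
  also have "\<dots> = FAr H k \<cdot>\<^bsub>D\<^esub> (FAr H (l \<boxtimes>\<^bsub>C\<^esub> Ident C c) \<cdot>\<^bsub>D\<^esub>
      ((?\<mu> (x \<otimes>\<^bsub>C\<^esub> c) c \<cdot>\<^bsub>D\<^esub> ((?\<mu> x c \<boxtimes>\<^bsub>D\<^esub> ?i c) \<cdot>\<^bsub>D\<^esub> Hc.W (FOb H x))) \<cdot>\<^bsub>D\<^esub> (?i x \<boxtimes>\<^bsub>D\<^esub> ?t)))"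
    by simp
  also have "\<dots> = transfer x (k \<cdot>\<^bsub>C\<^esub> coext C c \<delta> x l)"
    unfolding cofree_comult_image[OF assms(1)] by (simp add: transfer_def coext_def H.FAr_comp)
  finally show ?thesis .
qed

lemma transfer_counit:
  assumes [simp]: "x \<in> Ob C"
  shows "transfer x (cofree_counit C \<epsilon> x) = cofree_counit D (F.image_counit \<epsilon>) (FOb H x)"
proof -
  let ?i = "Ident D (FOb H x)" and ?\<mu> = "Mult H" and ?r = "FAr H (Runit C x)"
  have "FAr H \<epsilon> \<cdot>\<^bsub>D\<^esub> \<tau> c = \<tau> (Unit C) \<cdot>\<^bsub>D\<^esub> FAr F \<epsilon>"
    by (rule naturality[symmetric]) simp_all
  also have "FAr F \<epsilon> = MUnit F \<cdot>\<^bsub>D\<^esub> F.image_counit \<epsilon>"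
    by (simp add: F.image_counit_def)
  also have "\<tau> (Unit C) \<cdot>\<^bsub>D\<^esub> \<dots> = MUnit H \<cdot>\<^bsub>D\<^esub> F.image_counit \<epsilon>"
    by (simp flip: component_Unit)
  finally have \<epsilon>: "FAr H \<epsilon> \<cdot>\<^bsub>D\<^esub> \<tau> c = MUnit H \<cdot>\<^bsub>D\<^esub> F.image_counit \<epsilon>" .
  have "transfer x (cofree_counit C \<epsilon> x) =
      ?r \<cdot>\<^bsub>D\<^esub> ((FAr H (Ident C x \<boxtimes>\<^bsub>C\<^esub> \<epsilon>) \<cdot>\<^bsub>D\<^esub> ?\<mu> x c) \<cdot>\<^bsub>D\<^esub> (?i \<boxtimes>\<^bsub>D\<^esub> \<tau> c))"
    by (simp add: transfer_def cofree_counit_def H.FAr_comp)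
  also have "FAr H (Ident C x \<boxtimes>\<^bsub>C\<^esub> \<epsilon>) \<cdot>\<^bsub>D\<^esub> ?\<mu> x c = ?\<mu> x (Unit C) \<cdot>\<^bsub>D\<^esub> (?i \<boxtimes>\<^bsub>D\<^esub> FAr H \<epsilon>)"
    by (rule H.Mult_nat_right[symmetric]) simp_all
  also have "?r \<cdot>\<^bsub>D\<^esub> (\<dots> \<cdot>\<^bsub>D\<^esub> (?i \<boxtimes>\<^bsub>D\<^esub> \<tau> c)) =
      (?r \<cdot>\<^bsub>D\<^esub> ?\<mu> x (Unit C) \<cdot>\<^bsub>D\<^esub> (?i \<boxtimes>\<^bsub>D\<^esub> MUnit H)) \<cdot>\<^bsub>D\<^esub> (?i \<boxtimes>\<^bsub>D\<^esub> F.image_counit \<epsilon>)"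
    by (simp add: F.D.interchange \<epsilon>)
  also have "\<dots> = cofree_counit D (F.image_counit \<epsilon>) (FOb H x)"
    unfolding H.Mult_Runit[OF assms] by (simp add: cofree_counit_def)
  finally show ?thesis .
qed

lemma ext_transfer_inverse:
  assumes [simp]: "x \<in> Ob C" "l \<in> Ar C" "Src C l = x \<otimes>\<^bsub>C\<^esub> c" "Tgt C l = y"
    "k \<in> Ar C" "Src C k = y \<otimes>\<^bsub>C\<^esub> c" "Tgt C k = x"
    and kl: "k \<cdot>\<^bsub>C\<^esub> coext C c \<delta> x l = cofree_counit C \<epsilon> x"
  shows "ext (FOb H y) (transfer y k) \<cdot>\<^bsub>D\<^esub> ext (FOb H x) (transfer x l) =
    Ident D (FOb H x \<otimes>\<^bsub>D\<^esub> FOb F c)"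
proof -
  have [simp]: "y \<in> Ob C" using F.C.Tgt_in[of l] by simp
  show ?thesis
    by (subst Fc.coext_comp) (simp_all add: transfer_comp[where y=y] kl transfer_counit Fc.coext_counit)
qed

end

text \<open>
  An isomorphism \<open>x \<cong> s\<close> in the coKleisli category of \<open>- \<otimes> c\<close>, given by \<open>d\<close> and its inverse \<open>e\<close>, is
  transferred both along \<open>\<tau>\<close> and along the identity of \<open>F\<close>. It yields \<open>F x \<otimes> F c \<cong> F s \<otimes> F c\<close> and
  \<open>H x \<otimes> F c \<cong> H s \<otimes> F c\<close>, and conjugates \<open>\<tau> x \<otimes> F c\<close> into \<open>\<tau> s \<otimes> F c\<close>.
\<close>

theorem (in comonoid_transformation) tensor_iso_of_coKleisli_iso:
  assumes [simp]: "s \<in> Ob C" "x \<in> Ob C"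
    and [simp]: "d \<in> Ar C" "Src C d = x \<otimes>\<^bsub>C\<^esub> c" "Tgt C d = s"
    and [simp]: "e \<in> Ar C" "Src C e = s \<otimes>\<^bsub>C\<^esub> c" "Tgt C e = x"
    and de: "d \<cdot>\<^bsub>C\<^esub> coext C c \<delta> s e = cofree_counit C \<epsilon> s"
    and ed: "e \<cdot>\<^bsub>C\<^esub> coext C c \<delta> x d = cofree_counit C \<epsilon> x"
    and [simp]: "is_iso D (\<tau> s)"
  shows "is_iso D (\<tau> x \<boxtimes>\<^bsub>D\<^esub> Ident D (FOb F c))"
proof -
  interpret id: comonoid_transformation C D F F "\<lambda>x. Ident D (FOb F x)" c \<delta> \<epsilon>
    unfolding comonoid_transformation_def comonoid_transformation_axioms_def
    using F.identity_transformation comonoid by blast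
  let ?i = "Ident D (FOb F c)"
  let ?d' = "id.ext (FOb F x) (id.transfer x d)" and ?e' = "id.ext (FOb F s) (id.transfer s e)"
  let ?d = "ext (FOb H x) (transfer x d)" and ?e = "ext (FOb H s) (transfer s e)"
  have d': "is_iso D ?d'"
    by (rule is_isoI[of _ _ "FOb F x \<otimes>\<^bsub>D\<^esub> FOb F c" "FOb F s \<otimes>\<^bsub>D\<^esub> FOb F c" ?e'])
      (simp_all add: mem_Hom id.ext_transfer_inverse de ed)
  have e: "is_iso D ?e"
    by (rule is_isoI[of _ _ "FOb H s \<otimes>\<^bsub>D\<^esub> FOb F c" "FOb H x \<otimes>\<^bsub>D\<^esub> FOb F c" ?d])
      (simp_all add: mem_Hom ext_transfer_inverse de ed)
  have nat: "\<tau> x \<cdot>\<^bsub>D\<^esub> id.transfer s e = transfer s e \<cdot>\<^bsub>D\<^esub> (\<tau> s \<boxtimes>\<^bsub>D\<^esub> ?i)"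
  proof -
    have "\<tau> x \<cdot>\<^bsub>D\<^esub> id.transfer s e = (\<tau> x \<cdot>\<^bsub>D\<^esub> FAr F e) \<cdot>\<^bsub>D\<^esub> Mult F s c"
      by (simp add: id.transfer_def)
    also have "\<tau> x \<cdot>\<^bsub>D\<^esub> FAr F e = FAr H e \<cdot>\<^bsub>D\<^esub> \<tau> (s \<otimes>\<^bsub>C\<^esub> c)"
      by (rule naturality) simp_all
    also have "\<dots> \<cdot>\<^bsub>D\<^esub> Mult F s c = FAr H e \<cdot>\<^bsub>D\<^esub> (\<tau> (s \<otimes>\<^bsub>C\<^esub> c) \<cdot>\<^bsub>D\<^esub> Mult F s c)" by simp
    also have "\<dots> = transfer s e \<cdot>\<^bsub>D\<^esub> (\<tau> s \<boxtimes>\<^bsub>D\<^esub> ?i)"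
      by (subst component_comp_Mult) (simp_all add: transfer_def F.D.interchange)
    finally show ?thesis .
  qed
  have "\<tau> x \<boxtimes>\<^bsub>D\<^esub> ?i = (\<tau> x \<boxtimes>\<^bsub>D\<^esub> ?i) \<cdot>\<^bsub>D\<^esub> (?e' \<cdot>\<^bsub>D\<^esub> ?d')"
    by (subst id.ext_transfer_inverse) (simp_all add: ed)
  also have "\<dots> = ((\<tau> x \<boxtimes>\<^bsub>D\<^esub> ?i) \<cdot>\<^bsub>D\<^esub> ?e') \<cdot>\<^bsub>D\<^esub> ?d'" by simp
  also have "(\<tau> x \<boxtimes>\<^bsub>D\<^esub> ?i) \<cdot>\<^bsub>D\<^esub> ?e' = ?e \<cdot>\<^bsub>D\<^esub> (\<tau> s \<boxtimes>\<^bsub>D\<^esub> ?i)"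
    by (subst Fc.coext_postcomp) (simp_all add: nat Fc.coext_precomp[where x="FOb F s"])
  finally show ?thesis using d' e by (simp add: F.D.iso_Cmp)
qed

section \<open>Small sets\<close>

text \<open>
  An infinite set that bounds both factors also bounds their product, and one of the two factors bounds
  both of them. If it is finite, so is the product, and the universe is infinite.
\<close>

lemma small_Times:
  fixes X Y :: "'c set"
  assumes "inaccessible TYPE('u)" "small TYPE('u) X" "small TYPE('u) Y"
  shows "small TYPE('u) (X \<times> Y)"
proof -
  have less: "|X| <o |UNIV :: 'u set|" "|Y| <o |UNIV :: 'u set|" "natLeq <o |UNIV :: 'u set|"
    using assms by (simp_all add: small_def inaccessible_def)
  have *: "|X \<times> Y| <o |UNIV :: 'u set|"
    if Z: "|X| \<le>o |Z|" "|Y| \<le>o |Z|" "|Z| <o |UNIV :: 'u set|" for Z :: "'c set"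
  proof (cases "finite Z")
    case True
    hence "finite (X \<times> Y)"
      using card_of_ordLeq_finite[OF Z(1)] card_of_ordLeq_finite[OF Z(2)] by blast
    thus ?thesis using less(3) finite_iff_ordLess_natLeq ordLess_transitive by blast
  next
    case False
    hence "|X \<times> Y| \<le>o |Z|"
      using Z(1,2)
      by (intro card_of_Times_ordLeq_infinite_Field card_of_Card_order) (simp_all add: Field_card_of)
    thus ?thesis using Z(3) by (rule ordLeq_ordLess_trans)
  qed
  show ?thesis
    unfolding small_def
    using ordLeq_total[OF card_of_Well_order card_of_Well_order, of X Y] less *[of X] *[of Y]
      card_of_mono1[OF subset_refl, of X] card_of_mono1[OF subset_refl, of Y] by blast
qed

lemma inj_on_enc:
  assumes "small TYPE('u) X"
  shows "inj_on (enc X :: _ \<Rightarrow> 'u) X"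
proof -
  have "\<exists>e :: _ \<Rightarrow> 'u. inj_on e X"
    using assms unfolding small_def by (meson card_of_ordLeq ordLess_imp_ordLeq)
  thus ?thesis unfolding enc_def by (rule someI_ex)
qed

lemma dec_enc: "small TYPE('u) X \<Longrightarrow> a \<in> X \<Longrightarrow> dec X (enc X a :: 'u) = a"
  unfolding dec_def by (rule inv_into_f_f[OF inj_on_enc])

lemma small_subset: "small U B \<Longrightarrow> A \<subseteq> B \<Longrightarrow> small U A"
  unfolding small_def by (meson card_of_mono1 ordLeq_ordLess_trans)

lemma set_sym_simps:
  fixes f g :: "('u set, 'u \<Rightarrow> 'u) arrow" and X :: "'u set"
  shows "Ob set_sym = {X. small TYPE('u) (X :: 'u set)}"
  "f \<in> Ar set_sym \<longleftrightarrow> small TYPE('u) (src f) \<and> small TYPE('u) (tgt f) \<and> body f \<in> src f \<rightarrow>\<^sub>E tgt f"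
  "Src set_sym = src" "Tgt set_sym = tgt"
  "Ident set_sym X = Arrow X X (\<lambda>u\<in>X. u)"
  "Cmp set_sym g f = Arrow (src f) (tgt g) (compose (src f) (body g) (body f))"
proof -
  show "f \<in> Ar set_sym \<longleftrightarrow>
      small TYPE('u) (src f) \<and> small TYPE('u) (tgt f) \<and> body f \<in> src f \<rightarrow>\<^sub>E tgt f"
    by (cases f) (simp add: set_sym_def set_cat_def Let_def)
qed (simp_all add: set_sym_def set_cat_def Let_def)

lemma set_sym_tensor:
  fixes f g :: "('u set, 'u \<Rightarrow> 'u) arrow" and X Y Z :: "'u set"
  defines "one \<equiv> code {()} :: 'u set" and "cart \<equiv> \<lambda>X Y :: 'u set. code (X \<times> Y) :: 'u set"
  shows "TAr set_sym f g = code_map (src f \<times> src g) (tgt f \<times> tgt g) (map_prod (body f) (body g))"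
    "Assoc set_sym X Y Z = code_map (cart X Y \<times> Z) (X \<times> cart Y Z)
       (\<lambda>(p, z). case dec (X \<times> Y) p of (x, y) \<Rightarrow> (x, enc (Y \<times> Z) (y, z)))"
    "Lunit set_sym X = Arrow (cart one X) X (\<lambda>u\<in>cart one X. snd (dec (one \<times> X) u))"
    "Runit set_sym X = Arrow (cart X one) X (\<lambda>u\<in>cart X one. fst (dec (X \<times> one) u))"
  by (simp_all add: set_sym_def Let_def one_def cart_def)

section \<open>G-sets and their maps, elementwise\<close>

text \<open>
  In \<open>set_cat\<close> an arrow carries its domain and codomain, and products are transported along a chosen
  injection. The following operations recover actions, maps and pairs as plain functions on elements, so
  that equations between maps of G-sets are checked on elements.
\<close>

definition act :: "'u gset \<Rightarrow> 'u \<Rightarrow> 'u \<Rightarrow> 'u" where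
  "act F f u = body (FAr F f) u"

definition ev :: "('u gset, 'u \<Rightarrow> ('u set, 'u \<Rightarrow> 'u) arrow) arrow \<Rightarrow> 'u \<Rightarrow> 'u \<Rightarrow> 'u" where
  "ev t x u = body (body t x) u"

definition pair :: "'u gset \<Rightarrow> 'u gset \<Rightarrow> 'u \<Rightarrow> 'u \<Rightarrow> 'u \<Rightarrow> 'u" where
  "pair F H x u v = enc (FOb F x \<times> FOb H x) (u, v)"

definition pr1 :: "'u gset \<Rightarrow> 'u gset \<Rightarrow> 'u \<Rightarrow> 'u \<Rightarrow> 'u" where
  "pr1 F H x w = fst (dec (FOb F x \<times> FOb H x) w)"

definition pr2 :: "'u gset \<Rightarrow> 'u gset \<Rightarrow> 'u \<Rightarrow> 'u \<Rightarrow> 'u" where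
  "pr2 F H x w = snd (dec (FOb F x \<times> FOb H x) w)"

definition pt :: 'u where
  "pt = enc {()} ()"

text \<open>
  The monoidal laws of the category of G-sets are among the laws of a monoidal functor that starts there;
  they are taken as an assumption and also supply the closure properties of its objects and arrows.
\<close>

locale gsets = groupoid G for G :: "('u, 'u) cat" +
  assumes inaccessible: "inaccessible TYPE('u)"
    and small: "small_category G"
    and monoidal: "monoidal_category (gset_sym G)"
begin

abbreviation "GS \<equiv> gset_sym G"

sublocale GS: monoidal_category GS by (rule monoidal)

lemma GS_unfold:
  "Ob GS = {F. is_functor G set_sym F \<and> FOb F \<in> extensional (Ob G) \<and> FAr F \<in> extensional (Ar G)}"
  "Ar GS = {Arrow F H \<tau> | F H \<tau>. F \<in> Ob GS \<and> H \<in> Ob GS \<and> nat_trans G set_sym F H \<tau> \<and>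
     \<tau> \<in> extensional (Ob G)}"
  "Src GS = src" "Tgt GS = tgt"
  "Ident GS F = Arrow F F (\<lambda>x\<in>Ob G. Ident set_sym (FOb F x))"
  "Cmp GS t s = Arrow (src s) (tgt t) (\<lambda>x\<in>Ob G. body t x \<cdot>\<^bsub>set_sym\<^esub> body s x)"
  "FOb (Unit GS) = (\<lambda>x\<in>Ob G. code {()})"
  "FAr (Unit GS) = (\<lambda>f\<in>Ar G. Ident set_sym (code {()}))"
  "FOb (F \<otimes>\<^bsub>GS\<^esub> H) = (\<lambda>x\<in>Ob G. code (FOb F x \<times> FOb H x))"
  "FAr (F \<otimes>\<^bsub>GS\<^esub> H) = (\<lambda>f\<in>Ar G. FAr F f \<boxtimes>\<^bsub>set_sym\<^esub> FAr H f)"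
  "body (s \<boxtimes>\<^bsub>GS\<^esub> t) = (\<lambda>x\<in>Ob G. body s x \<boxtimes>\<^bsub>set_sym\<^esub> body t x)"
  "body (Assoc GS F H K) = (\<lambda>x\<in>Ob G. Assoc set_sym (FOb F x) (FOb H x) (FOb K x))"
  "body (Lunit GS F) = (\<lambda>x\<in>Ob G. Lunit set_sym (FOb F x))"
  "body (Runit GS F) = (\<lambda>x\<in>Ob G. Runit set_sym (FOb F x))"
  by (simp_all add: gset_sym_def fun_sym_def fun_cat_def Let_def, simp_all add: set_sym_def Let_def)

text \<open>
  The terminal G-set is a functor to sets, which includes that sets form a category.
\<close>

lemma category_set_sym: "category (set_sym :: ('u set, ('u set, 'u \<Rightarrow> 'u) arrow) symcat)"
  using GS.Unit_in unfolding GS_unfold is_functor_def by blast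

lemma
  assumes F: "F \<in> Ob GS"
  shows small_FOb [simp]: "x \<in> Ob G \<Longrightarrow> small TYPE('u) (FOb F x)"
    and act_in [simp]: "f \<in> Ar G \<Longrightarrow> Src G f = x \<Longrightarrow> Tgt G f = y \<Longrightarrow> u \<in> FOb F x \<Longrightarrow> act F f u \<in> FOb F y"
    and act_Ident [simp]: "x \<in> Ob G \<Longrightarrow> u \<in> FOb F x \<Longrightarrow> act F (Ident G x) u = u"
    and act_Cmp: "f \<in> Ar G \<Longrightarrow> g \<in> Ar G \<Longrightarrow> Src G g = Tgt G f \<Longrightarrow> u \<in> FOb F (Src G f) \<Longrightarrow>
      act F (g \<cdot>\<^bsub>G\<^esub> f) u = act F g (act F f u)"
    and src_FAr: "f \<in> Ar G \<Longrightarrow> src (FAr F f) = FOb F (Src G f)"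
    and tgt_FAr: "f \<in> Ar G \<Longrightarrow> tgt (FAr F f) = FOb F (Tgt G f)"
proof -
  interpret F: is_functor G set_sym F using F by (simp add: GS_unfold)
  show "small TYPE('u) (FOb F x)" if "x \<in> Ob G"
    using F.FOb_Ob[OF that] by (simp add: set_sym_simps)
  have *: "FAr F f \<in> Ar set_sym" "src (FAr F f) = FOb F (Src G f)"
    "tgt (FAr F f) = FOb F (Tgt G f)" if "f \<in> Ar G" for f
    using F.FAr_simps[OF that] by (simp_all add: set_sym_simps(3,4))
  show "f \<in> Ar G \<Longrightarrow> src (FAr F f) = FOb F (Src G f)" "f \<in> Ar G \<Longrightarrow> tgt (FAr F f) = FOb F (Tgt G f)"
    using * by simp_all
  show "act F f u \<in> FOb F y" if "f \<in> Ar G" "Src G f = x" "Tgt G f = y" "u \<in> FOb F x"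
    using *[OF that(1)] that unfolding set_sym_simps act_def by auto
  show "act F (Ident G x) u = u" if "x \<in> Ob G" "u \<in> FOb F x"
    using that by (simp add: act_def set_sym_simps)
  show "act F (g \<cdot>\<^bsub>G\<^esub> f) u = act F g (act F f u)"
    if "f \<in> Ar G" "g \<in> Ar G" "Src G g = Tgt G f" "u \<in> FOb F (Src G f)"
    using that * by (simp add: act_def F.FAr_comp set_sym_simps compose_def)
qed

definition gobj :: "('u \<Rightarrow> 'u set) \<Rightarrow> ('u \<Rightarrow> 'u \<Rightarrow> 'u) \<Rightarrow> 'u gset" where
  "gobj X \<rho> = \<lparr>FOb = restrict X (Ob G),
     FAr = (\<lambda>f\<in>Ar G. Arrow (X (Src G f)) (X (Tgt G f)) (restrict (\<rho> f) (X (Src G f))))\<rparr>"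

lemma gobj_simps [simp]:
  "x \<in> Ob G \<Longrightarrow> FOb (gobj X \<rho>) x = X x"
  "f \<in> Ar G \<Longrightarrow> u \<in> X (Src G f) \<Longrightarrow> act (gobj X \<rho>) f u = \<rho> f u"
  by (simp_all add: gobj_def act_def)

lemma gobj_in:
  assumes "\<And>x. x \<in> Ob G \<Longrightarrow> small TYPE('u) (X x)"
    and "\<And>f u. f \<in> Ar G \<Longrightarrow> u \<in> X (Src G f) \<Longrightarrow> \<rho> f u \<in> X (Tgt G f)"
    and "\<And>x u. x \<in> Ob G \<Longrightarrow> u \<in> X x \<Longrightarrow> \<rho> (Ident G x) u = u"
    and "\<And>f g u. f \<in> Ar G \<Longrightarrow> g \<in> Ar G \<Longrightarrow> Src G g = Tgt G f \<Longrightarrow> u \<in> X (Src G f) \<Longrightarrow>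
      \<rho> (g \<cdot>\<^bsub>G\<^esub> f) u = \<rho> g (\<rho> f u)"
  shows "gobj X \<rho> \<in> Ob GS"
proof -
  interpret S: category "set_sym :: ('u set, ('u set, 'u \<Rightarrow> 'u) arrow) symcat"
    by (rule category_set_sym)
  have "is_functor G set_sym (gobj X \<rho>)"
  proof unfold_locales
    fix f x y assume f: "f \<in> Hom G x y"
    then show "FAr (gobj X \<rho>) f \<in> Hom set_sym (FOb (gobj X \<rho>) x) (FOb (gobj X \<rho>) y)"
      using assms(1,2) by (auto simp: mem_Hom gobj_def set_sym_simps)
    fix g z assume "g \<in> Hom G y z"
    with f show "FAr (gobj X \<rho>) (g \<cdot>\<^bsub>G\<^esub> f) = FAr (gobj X \<rho>) g \<cdot>\<^bsub>set_sym\<^esub> FAr (gobj X \<rho>) f"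
      using assms(2,4) by (auto simp: mem_Hom gobj_def set_sym_simps compose_def restrict_def)
  next
    fix x assume "x \<in> Ob G"
    then show "FAr (gobj X \<rho>) (Ident G x) = Ident set_sym (FOb (gobj X \<rho>) x)"
      using assms(3) by (auto simp: gobj_def set_sym_simps restrict_def)
  qed (use assms(1) in \<open>auto simp: gobj_def set_sym_simps\<close>)
  thus ?thesis by (simp add: GS_unfold gobj_def)
qed

lemma
  assumes t: "t \<in> Ar GS"
  shows ev_in [simp]: "x \<in> Ob G \<Longrightarrow> Src GS t = F \<Longrightarrow> Tgt GS t = H \<Longrightarrow> u \<in> FOb F x \<Longrightarrow> ev t x u \<in> FOb H x"
    and ev_act: "f \<in> Ar G \<Longrightarrow> Src G f = x \<Longrightarrow> Tgt G f = y \<Longrightarrow> u \<in> FOb (Src GS t) x \<Longrightarrow>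
      ev t y (act (Src GS t) f u) = act (Tgt GS t) f (ev t x u)"
    and component_form: "x \<in> Ob G \<Longrightarrow>
      body t x = Arrow (FOb (Src GS t) x) (FOb (Tgt GS t) x) (restrict (ev t x) (FOb (Src GS t) x))"
    and body_extensional: "body t \<in> extensional (Ob G)"
proof -
  obtain A B \<tau> where t_eq: "t = Arrow A B \<tau>" and AB: "A \<in> Ob GS" "B \<in> Ob GS"
    and nt: "nat_trans G set_sym A B \<tau>" and e: "\<tau> \<in> extensional (Ob G)"
    using t unfolding GS_unfold(2) by blast
  interpret nat_trans G set_sym A B \<tau> by (rule nt)
  have *: "src (\<tau> x) = FOb A x" "tgt (\<tau> x) = FOb B x" "body (\<tau> x) \<in> FOb A x \<rightarrow>\<^sub>E FOb B x"
    if "x \<in> Ob G" for x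
    using component_simps[OF that] by (auto simp: set_sym_simps)
  show "ev t x u \<in> FOb H x" if "x \<in> Ob G" "Src GS t = F" "Tgt GS t = H" "u \<in> FOb F x"
    using *[OF that(1)] that by (auto simp: t_eq GS_unfold ev_def)
  show "body t x = Arrow (FOb (Src GS t) x) (FOb (Tgt GS t) x) (restrict (ev t x) (FOb (Src GS t) x))"
    if "x \<in> Ob G"
    using *[OF that] by (cases "\<tau> x") (auto simp: t_eq GS_unfold ev_def[abs_def] restrict_def PiE_def extensional_def)
  show "body t \<in> extensional (Ob G)" using e by (simp add: t_eq)
  show "ev t y (act (Src GS t) f u) = act (Tgt GS t) f (ev t x u)"
    if "f \<in> Ar G" "Src G f = x" "Tgt G f = y" "u \<in> FOb (Src GS t) x"
  proof -
    have xy: "x \<in> Ob G" "y \<in> Ob G" using that by auto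
    have u: "u \<in> FOb A x" using that by (simp add: t_eq GS_unfold)
    have "body (\<tau> y \<cdot>\<^bsub>set_sym\<^esub> FAr A f) u = body (FAr B f \<cdot>\<^bsub>set_sym\<^esub> \<tau> x) u"
      using naturality[of f x y] that by simp
    thus ?thesis
      using that u * xy AB by (simp add: set_sym_simps compose_def src_FAr t_eq GS_unfold(3,4) ev_def act_def)
  qed
qed

definition garr :: "'u gset \<Rightarrow> 'u gset \<Rightarrow> ('u \<Rightarrow> 'u \<Rightarrow> 'u) \<Rightarrow>
    ('u gset, 'u \<Rightarrow> ('u set, 'u \<Rightarrow> 'u) arrow) arrow" where
  "garr F H \<phi> = Arrow F H (\<lambda>x\<in>Ob G. Arrow (FOb F x) (FOb H x) (restrict (\<phi> x) (FOb F x)))"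

lemma garr_simps [simp]:
  "Src GS (garr F H \<phi>) = F" "Tgt GS (garr F H \<phi>) = H"
  "x \<in> Ob G \<Longrightarrow> u \<in> FOb F x \<Longrightarrow> ev (garr F H \<phi>) x u = \<phi> x u"
  by (simp_all add: garr_def GS_unfold ev_def)

lemma garr_in:
  assumes FH: "F \<in> Ob GS" "H \<in> Ob GS"
    and \<phi>: "\<And>x u. x \<in> Ob G \<Longrightarrow> u \<in> FOb F x \<Longrightarrow> \<phi> x u \<in> FOb H x"
    and nat: "\<And>f x y u. f \<in> Ar G \<Longrightarrow> Src G f = x \<Longrightarrow> Tgt G f = y \<Longrightarrow> x \<in> Ob G \<Longrightarrow> y \<in> Ob G \<Longrightarrow> u \<in> FOb F x \<Longrightarrow>
      \<phi> y (act F f u) = act H f (\<phi> x u)"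
  shows "garr F H \<phi> \<in> Ar GS"
proof -
  interpret F: is_functor G set_sym F using FH by (simp add: GS_unfold)
  interpret H: is_functor G set_sym H using FH by (simp add: GS_unfold)
  have *: "nat_trans G set_sym F H (body (garr F H \<phi>))"
  proof unfold_locales
    fix x assume "x \<in> Ob G"
    then show "body (garr F H \<phi>) x \<in> Hom set_sym (FOb F x) (FOb H x)"
      using FH \<phi> by (auto simp: garr_def set_sym_simps mem_Hom)
  next
    fix f x y assume f: "f \<in> Hom G x y"
    hence xy: "x \<in> Ob G" "y \<in> Ob G" by (auto simp: mem_Hom)
    have "\<phi> y (body (FAr F f) u) = body (FAr H f) (\<phi> x u)" if "u \<in> FOb F x" for u
      using nat[of f x y u] f that xy by (simp add: act_def mem_Hom)
    moreover have "body (FAr F f) u \<in> FOb F y" if "u \<in> FOb F x" for u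
      using act_in[OF FH(1), of f x y u] f that by (simp add: act_def mem_Hom)
    ultimately
    show "body (garr F H \<phi>) y \<cdot>\<^bsub>set_sym\<^esub> FAr F f = FAr H f \<cdot>\<^bsub>set_sym\<^esub> body (garr F H \<phi>) x"
      using f xy \<phi> FH by (auto simp: garr_def set_sym_simps compose_def src_FAr tgt_FAr mem_Hom restrict_def)
  qed
  show ?thesis
    unfolding GS_unfold(2) using * FH by (auto simp: garr_def)
qed

lemma
  assumes "t \<in> Ar GS" "x \<in> Ob G"
  shows src_component: "src (body t x) = FOb (Src GS t) x"
    and tgt_component: "tgt (body t x) = FOb (Tgt GS t) x"
  by (simp_all add: component_form[OF assms])

text \<open>
  Components are extensional functions on extensional domains, so their values on elements determine
  an arrow.
\<close>

lemma garr_eqI: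
  assumes st: "s \<in> Ar GS" "t \<in> Ar GS" "Src GS s = F" "Src GS t = F" "Tgt GS s = H" "Tgt GS t = H"
    and ev: "\<And>x u. x \<in> Ob G \<Longrightarrow> u \<in> FOb F x \<Longrightarrow> ev s x u = ev t x u"
  shows "s = t"
proof -
  have "body s x = body t x" if "x \<in> Ob G" for x
    unfolding component_form[OF st(1) that] component_form[OF st(2) that] st(3-)
    using ev[OF that] by (auto simp: restrict_def)
  hence "body s = body t"
    using body_extensional[OF st(1)] body_extensional[OF st(2)] by (metis extensionalityI)
  thus ?thesis using st(3-) by (cases s; cases t) (simp add: GS_unfold)
qed

lemma ev_Cmp [simp]:
  assumes "s \<in> Ar GS" "t \<in> Ar GS" "Src GS t = Tgt GS s" "x \<in> Ob G" "u \<in> FOb (Src GS s) x"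
  shows "ev (t \<cdot>\<^bsub>GS\<^esub> s) x u = ev t x (ev s x u)"
  using assms src_component[OF assms(1,4)]
  by (simp add: ev_def GS_unfold(6) set_sym_simps compose_def)

lemma ev_Ident [simp]: "x \<in> Ob G \<Longrightarrow> u \<in> FOb F x \<Longrightarrow> ev (Ident GS F) x u = u"
  by (simp add: ev_def GS_unfold set_sym_simps)

section \<open>Products\<close>

lemma pr_pair [simp]:
  assumes "F \<in> Ob GS" "H \<in> Ob GS" "x \<in> Ob G" "u \<in> FOb F x" "v \<in> FOb H x"
  shows "pr1 F H x (pair F H x u v) = u" "pr2 F H x (pair F H x u v) = v"
  using dec_enc[OF small_Times[OF inaccessible small_FOb small_FOb], of F x H x "(u, v)"] assms
  by (simp_all add: pr1_def pr2_def pair_def)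

lemma pair_in [simp]:
  assumes "x \<in> Ob G" "u \<in> FOb F x" "v \<in> FOb H x"
  shows "pair F H x u v \<in> FOb (F \<otimes>\<^bsub>GS\<^esub> H) x"
  using assms by (auto simp: GS_unfold pair_def code_def)

lemma tensor_cases:
  assumes "w \<in> FOb (F \<otimes>\<^bsub>GS\<^esub> H) x" "x \<in> Ob G"
  obtains u v where "u \<in> FOb F x" "v \<in> FOb H x" "w = pair F H x u v"
  using assms by (auto simp: GS_unfold pair_def code_def)

lemma act_pair [simp]:
  assumes "F \<in> Ob GS" "H \<in> Ob GS" "f \<in> Ar G" "Src G f = x" "Tgt G f = y" "u \<in> FOb F x" "v \<in> FOb H x"
  shows "act (F \<otimes>\<^bsub>GS\<^esub> H) f (pair F H x u v) = pair F H y (act F f u) (act H f v)"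
proof -
  have x: "x \<in> Ob G" using assms by auto
  have "dec (FOb F x \<times> FOb H x) (pair F H x u v) = (u, v)"
    using pr_pair[OF assms(1,2) x assms(6,7)] unfolding pr1_def pr2_def by (simp add: prod_eq_iff)
  moreover have "pair F H x u v \<in> code (FOb F x \<times> FOb H x)"
    using pair_in[OF x assms(6,7)] x by (simp add: GS_unfold)
  ultimately show ?thesis
    using assms unfolding act_def GS_unfold(10)
    by (simp add: set_sym_tensor code_map_def src_FAr tgt_FAr pair_def)
qed

lemma ev_tensor [simp]:
  assumes s: "s \<in> Ar GS" "Src GS s = F" "Tgt GS s = F'" and t: "t \<in> Ar GS" "Src GS t = H" "Tgt GS t = H'"
    and x: "x \<in> Ob G" "u \<in> FOb F x" "v \<in> FOb H x"
  shows "ev (s \<boxtimes>\<^bsub>GS\<^esub> t) x (pair F H x u v) = pair F' H' x (ev s x u) (ev t x v)"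
proof -
  have FH: "F \<in> Ob GS" "H \<in> Ob GS" using s t by auto
  have "dec (FOb F x \<times> FOb H x) (pair F H x u v) = (u, v)"
    using pr_pair[OF FH x] unfolding pr1_def pr2_def by (simp add: prod_eq_iff)
  moreover have "pair F H x u v \<in> code (FOb F x \<times> FOb H x)"
    using pair_in[OF x] x by (simp add: GS_unfold)
  ultimately show ?thesis
    using src_component tgt_component s t x
    unfolding ev_def GS_unfold(11) by (simp add: set_sym_tensor code_map_def pair_def)
qed

lemma ev_Assoc [simp]:
  assumes FHK: "F \<in> Ob GS" "H \<in> Ob GS" "K \<in> Ob GS"
    and x: "x \<in> Ob G" "u \<in> FOb F x" "v \<in> FOb H x" "w \<in> FOb K x"
  shows "ev (Assoc GS F H K) x (pair (F \<otimes>\<^bsub>GS\<^esub> H) K x (pair F H x u v) w) =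
    pair F (H \<otimes>\<^bsub>GS\<^esub> K) x u (pair H K x v w)"
proof -
  let ?p = "pair F H x u v" and ?q = "pair (F \<otimes>\<^bsub>GS\<^esub> H) K x (pair F H x u v) w"
  have p: "?p \<in> FOb (F \<otimes>\<^bsub>GS\<^esub> H) x" and q: "?q \<in> FOb (F \<otimes>\<^bsub>GS\<^esub> H \<otimes>\<^bsub>GS\<^esub> K) x" using FHK x by simp_all
  have "dec (FOb F x \<times> FOb H x) ?p = (u, v)"
    using pr_pair[of F H x u v] FHK x unfolding pr1_def pr2_def by (simp add: prod_eq_iff)
  moreover have "dec (FOb (F \<otimes>\<^bsub>GS\<^esub> H) x \<times> FOb K x) ?q = (?p, w)"
    using pr_pair[of "F \<otimes>\<^bsub>GS\<^esub> H" K x ?p w] FHK x unfolding pr1_def pr2_def by (simp add: prod_eq_iff)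
  ultimately show ?thesis
    using q p x unfolding ev_def GS_unfold(12)
    by (simp add: set_sym_tensor code_map_def GS_unfold(9) pair_def[of F "H \<otimes>\<^bsub>GS\<^esub> K"] pair_def[of H K])
qed

lemma ev_Lunit [simp]:
  assumes "F \<in> Ob GS" "x \<in> Ob G" "p \<in> FOb (Unit GS) x" "u \<in> FOb F x"
  shows "ev (Lunit GS F) x (pair (Unit GS) F x p u) = u"
  using pr_pair(2)[of "Unit GS" F x p u] pair_in[of x p "Unit GS" u F] assms
  unfolding ev_def pr2_def by (simp add: set_sym_tensor GS_unfold(7,9,13))

lemma ev_Runit [simp]:
  assumes "F \<in> Ob GS" "x \<in> Ob G" "p \<in> FOb (Unit GS) x" "u \<in> FOb F x"
  shows "ev (Runit GS F) x (pair F (Unit GS) x u p) = u"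
  using pr_pair(1)[of F "Unit GS" x u p] pair_in[of x u F p "Unit GS"] assms
  unfolding ev_def pr1_def by (simp add: set_sym_tensor GS_unfold(7,9,14))

lemma FOb_Unit [simp]: "x \<in> Ob G \<Longrightarrow> FOb (Unit GS) x = {pt}"
  by (simp add: GS_unfold code_def pt_def)

lemma act_Unit [simp]: "f \<in> Ar G \<Longrightarrow> act (Unit GS) f pt = pt"
  by (simp add: act_def GS_unfold set_sym_simps code_def pt_def)

section \<open>The diagonal comonoid\<close>

text \<open>
  The tensor product is the cartesian one, so the diagonal and the map to the terminal object make every
  G-set a comonoid.
\<close>

definition dup :: "'u gset \<Rightarrow> ('u gset, 'u \<Rightarrow> ('u set, 'u \<Rightarrow> 'u) arrow) arrow" where
  "dup P = garr P (P \<otimes>\<^bsub>GS\<^esub> P) (\<lambda>x u. pair P P x u u)"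

definition bang :: "'u gset \<Rightarrow> ('u gset, 'u \<Rightarrow> ('u set, 'u \<Rightarrow> 'u) arrow) arrow" where
  "bang P = garr P (Unit GS) (\<lambda>x u. pt)"

lemma dup_simps [simp]:
  assumes [simp]: "P \<in> Ob GS"
  shows "dup P \<in> Ar GS" "Src GS (dup P) = P" "Tgt GS (dup P) = P \<otimes>\<^bsub>GS\<^esub> P"
    "x \<in> Ob G \<Longrightarrow> u \<in> FOb P x \<Longrightarrow> ev (dup P) x u = pair P P x u u"
  unfolding dup_def by (rule garr_in) simp_all

lemma bang_simps [simp]:
  assumes [simp]: "P \<in> Ob GS"
  shows "bang P \<in> Ar GS" "Src GS (bang P) = P" "Tgt GS (bang P) = Unit GS"
    "x \<in> Ob G \<Longrightarrow> u \<in> FOb P x \<Longrightarrow> ev (bang P) x u = pt"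
  unfolding bang_def by (rule garr_in) simp_all

lemma diagonal_comonoid:
  assumes [simp]: "P \<in> Ob GS"
  shows "left_counital_comonoid GS P (dup P) (bang P)"
  unfolding left_counital_comonoid_def
proof (intro conjI)
  show "Assoc GS P P P \<cdot>\<^bsub>GS\<^esub> (dup P \<boxtimes>\<^bsub>GS\<^esub> Ident GS P) \<cdot>\<^bsub>GS\<^esub> dup P =
      (Ident GS P \<boxtimes>\<^bsub>GS\<^esub> dup P) \<cdot>\<^bsub>GS\<^esub> dup P"
    by (rule garr_eqI[where F = P]) simp_all
  show "Lunit GS P \<cdot>\<^bsub>GS\<^esub> (bang P \<boxtimes>\<^bsub>GS\<^esub> Ident GS P) \<cdot>\<^bsub>GS\<^esub> dup P = Ident GS P"
    by (rule garr_eqI[where F = P]) simp_all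
qed (simp_all add: mem_Hom)

text \<open>
  The inverse of the associator is eliminated by exhibiting the map \<open>(u, h) \<mapsto> ((u, h), h)\<close> and composing
  it with the associator.
\<close>

lemma ev_cofree_comult:
  assumes [simp]: "P \<in> Ob GS" "F \<in> Ob GS" "x \<in> Ob G" "u \<in> FOb F x" "h \<in> FOb P x"
  shows "ev (cofree_comult GS P (dup P) F) x (pair F P x u h) =
    pair (F \<otimes>\<^bsub>GS\<^esub> P) P x (pair F P x u h) h"
proof -
  let ?FP = "F \<otimes>\<^bsub>GS\<^esub> P"
  let ?W = "garr ?FP (?FP \<otimes>\<^bsub>GS\<^esub> P) (\<lambda>x w. pair ?FP P x w (pr2 F P x w))"
  have [simp]: "?W \<in> Ar GS"
    by (rule garr_in) (auto elim!: tensor_cases)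
  have "Ident GS F \<boxtimes>\<^bsub>GS\<^esub> dup P = Assoc GS F P P \<cdot>\<^bsub>GS\<^esub> ?W"
    by (rule garr_eqI) (auto elim!: tensor_cases)
  hence "cofree_comult GS P (dup P) F = ?W"
    by (simp add: cofree_comult_def)
  thus ?thesis by simp
qed

lemma ev_coext:
  assumes [simp]: "P \<in> Ob GS" "F \<in> Ob GS" "k \<in> Ar GS" "Src GS k = F \<otimes>\<^bsub>GS\<^esub> P" "Tgt GS k = H"
    "x \<in> Ob G" "u \<in> FOb F x" "h \<in> FOb P x"
  shows "ev (coext GS P (dup P) F k) x (pair F P x u h) = pair H P x (ev k x (pair F P x u h)) h"
proof -
  interpret comonoid_object GS P "dup P" "bang P"
    by unfold_locales (simp add: diagonal_comonoid)
  show ?thesis by (simp add: coext_def ev_cofree_comult)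
qed

lemma ev_cofree_counit:
  assumes [simp]: "P \<in> Ob GS" "F \<in> Ob GS" "x \<in> Ob G" "u \<in> FOb F x" "h \<in> FOb P x"
  shows "ev (cofree_counit GS (bang P) F) x (pair F P x u h) = u"
  by (simp add: cofree_counit_def)

section \<open>Representable and constant G-sets\<close>

definition rep :: "'u \<Rightarrow> 'u gset" where
  "rep g = gobj (Hom G g) (\<lambda>f h. f \<cdot>\<^bsub>G\<^esub> h)"

definition const :: "'u set \<Rightarrow> 'u gset" where
  "const S = gobj (\<lambda>_. S) (\<lambda>_ s. s)"

lemma small_Hom: "small TYPE('u) (Hom G g x)"
  using small unfolding small_category_def by (auto intro: small_subset simp: Hom_def)

lemma rep_simps [simp]:
  shows "g \<in> Ob G \<Longrightarrow> rep g \<in> Ob GS"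
    and "x \<in> Ob G \<Longrightarrow> FOb (rep g) x = Hom G g x"
    and "f \<in> Ar G \<Longrightarrow> h \<in> Hom G g (Src G f) \<Longrightarrow> act (rep g) f h = f \<cdot>\<^bsub>G\<^esub> h"
  unfolding rep_def by (auto intro!: gobj_in small_Hom simp: mem_Hom)

lemma const_simps [simp]:
  shows "small TYPE('u) S \<Longrightarrow> const S \<in> Ob GS"
    and "x \<in> Ob G \<Longrightarrow> FOb (const S) x = S"
    and "f \<in> Ar G \<Longrightarrow> s \<in> S \<Longrightarrow> act (const S) f s = s"
  unfolding const_def by (auto intro!: gobj_in)

text \<open>
  The mutually inverse coKleisli arrows \<open>(v, h) \<mapsto> h\<^sup>-\<^sup>1 v\<close> and \<open>(s, h) \<mapsto> h s\<close> between \<open>F\<close> and the constant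
  G-set on \<open>F(g)\<close>, for the comonad \<open>- \<otimes> Hom(g, -)\<close>. Inverses in \<open>G\<close> are what makes the first one exist.
\<close>

definition trivialize :: "'u gset \<Rightarrow> 'u \<Rightarrow> ('u gset, 'u \<Rightarrow> ('u set, 'u \<Rightarrow> 'u) arrow) arrow" where
  "trivialize F g = garr (F \<otimes>\<^bsub>GS\<^esub> rep g) (const (FOb F g))
     (\<lambda>x w. act F (inv_ar G (pr2 F (rep g) x w)) (pr1 F (rep g) x w))"

definition evaluate :: "'u gset \<Rightarrow> 'u \<Rightarrow> ('u gset, 'u \<Rightarrow> ('u set, 'u \<Rightarrow> 'u) arrow) arrow" where
  "evaluate F g = garr (const (FOb F g) \<otimes>\<^bsub>GS\<^esub> rep g) F
     (\<lambda>x w. act F (pr2 (const (FOb F g)) (rep g) x w) (pr1 (const (FOb F g)) (rep g) x w))"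

lemma trivialize_simps [simp]:
  assumes [simp]: "F \<in> Ob GS" "g \<in> Ob G"
  shows "trivialize F g \<in> Ar GS" "Src GS (trivialize F g) = F \<otimes>\<^bsub>GS\<^esub> rep g"
    "Tgt GS (trivialize F g) = const (FOb F g)"
    "x \<in> Ob G \<Longrightarrow> u \<in> FOb F x \<Longrightarrow> h \<in> Hom G g x \<Longrightarrow>
      ev (trivialize F g) x (pair F (rep g) x u h) = act F (inv_ar G h) u"
proof -
  note [simp] = all_iso mem_Hom
  show "trivialize F g \<in> Ar GS"
    unfolding trivialize_def
  proof (rule garr_in)
    fix f x y w
    assume [simp]: "f \<in> Ar G" "Src G f = x" "Tgt G f = y" "x \<in> Ob G" "y \<in> Ob G"
      and w: "w \<in> FOb (F \<otimes>\<^bsub>GS\<^esub> rep g) x"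
    from w obtain u h where w_eq: "w = pair F (rep g) x u h"
      and [simp]: "u \<in> FOb F x" "h \<in> Ar G" "Src G h = g" "Tgt G h = x"
      by (rule tensor_cases) simp_all
    \<comment> \<open>Naturality says \<open>(f h)\<^sup>-\<^sup>1 (f u) = h\<^sup>-\<^sup>1 u\<close>, which is functoriality at \<open>u = h ?v\<close>.\<close>
    let ?v = "act F (inv_ar G h) u"
    have "act F f u = act F f (act F (h \<cdot>\<^bsub>G\<^esub> inv_ar G h) u)" by simp
    also have "\<dots> = act F (f \<cdot>\<^bsub>G\<^esub> h) ?v"
      by (simp add: act_Cmp del: inv_ar_right)
    finally have "act F (inv_ar G (f \<cdot>\<^bsub>G\<^esub> h)) (act F f u) =
        act F (inv_ar G (f \<cdot>\<^bsub>G\<^esub> h) \<cdot>\<^bsub>G\<^esub> (f \<cdot>\<^bsub>G\<^esub> h)) ?v"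
      by (simp add: act_Cmp del: inv_ar_left Cmp_assoc_right)
    also have "\<dots> = ?v" by simp
    finally show "act F (inv_ar G (pr2 F (rep g) y (act (F \<otimes>\<^bsub>GS\<^esub> rep g) f w)))
        (pr1 F (rep g) y (act (F \<otimes>\<^bsub>GS\<^esub> rep g) f w)) =
      act (const (FOb F g)) f (act F (inv_ar G (pr2 F (rep g) x w)) (pr1 F (rep g) x w))"
      by (simp add: w_eq)
  qed (auto elim!: tensor_cases)
  show "x \<in> Ob G \<Longrightarrow> u \<in> FOb F x \<Longrightarrow> h \<in> Hom G g x \<Longrightarrow>
      ev (trivialize F g) x (pair F (rep g) x u h) = act F (inv_ar G h) u"
    by (simp add: trivialize_def)
qed (simp_all add: trivialize_def)

lemma evaluate_simps [simp]:
  assumes [simp]: "F \<in> Ob GS" "g \<in> Ob G"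
  shows "evaluate F g \<in> Ar GS" "Src GS (evaluate F g) = const (FOb F g) \<otimes>\<^bsub>GS\<^esub> rep g"
    "Tgt GS (evaluate F g) = F"
    "x \<in> Ob G \<Longrightarrow> s \<in> FOb F g \<Longrightarrow> h \<in> Hom G g x \<Longrightarrow>
      ev (evaluate F g) x (pair (const (FOb F g)) (rep g) x s h) = act F h s"
proof -
  note [simp] = mem_Hom
  show "evaluate F g \<in> Ar GS"
    unfolding evaluate_def by (rule garr_in) (auto elim!: tensor_cases simp: act_Cmp)
  show "x \<in> Ob G \<Longrightarrow> s \<in> FOb F g \<Longrightarrow> h \<in> Hom G g x \<Longrightarrow>
      ev (evaluate F g) x (pair (const (FOb F g)) (rep g) x s h) = act F h s"
    by (simp add: evaluate_def)
qed (simp_all add: evaluate_def)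

lemma trivialize_evaluate:
  assumes [simp]: "F \<in> Ob GS" "g \<in> Ob G"
  defines "S \<equiv> const (FOb F g)" and "P \<equiv> rep g"
  shows "trivialize F g \<cdot>\<^bsub>GS\<^esub> coext GS P (dup P) S (evaluate F g) = cofree_counit GS (bang P) S"
    and "evaluate F g \<cdot>\<^bsub>GS\<^esub> coext GS P (dup P) F (trivialize F g) = cofree_counit GS (bang P) F"
proof -
  have [simp]: "S \<in> Ob GS" "P \<in> Ob GS" by (simp_all add: S_def P_def)
  interpret P: comonoid_object GS P "dup P" "bang P"
    by unfold_locales (simp add: diagonal_comonoid)
  have [simp]: "Src GS (evaluate F g) = S \<otimes>\<^bsub>GS\<^esub> P" "Tgt GS (trivialize F g) = S"
    "Src GS (trivialize F g) = F \<otimes>\<^bsub>GS\<^esub> P" by (simp_all add: S_def P_def)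
  have inv: "inv_ar G h \<in> Ar G" "Src G (inv_ar G h) = x" "Tgt G (inv_ar G h) = g"
    "u \<in> FOb F g \<Longrightarrow> act F (inv_ar G h) (act F h u) = u"
    "v \<in> FOb F x \<Longrightarrow> act F h (act F (inv_ar G h) v) = v"
    if "h \<in> Hom G g x" for h x u v
    using that act_Cmp[of F h "inv_ar G h" u] act_Cmp[of F "inv_ar G h" h v] all_iso[of h]
    by (auto simp: mem_Hom)
  show "trivialize F g \<cdot>\<^bsub>GS\<^esub> coext GS P (dup P) S (evaluate F g) = cofree_counit GS (bang P) S"
  proof (rule garr_eqI)
    fix x w assume [simp]: "x \<in> Ob G" and "w \<in> FOb (S \<otimes>\<^bsub>GS\<^esub> P) x"
    then obtain s h where w: "w = pair S P x s h" and [simp]: "s \<in> FOb S x" "h \<in> FOb P x"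
      by (elim tensor_cases)
    have [simp]: "s \<in> FOb F g" "h \<in> Hom G g x"
      using \<open>s \<in> FOb S x\<close> \<open>h \<in> FOb P x\<close> by (simp_all add: S_def P_def)
    have [simp]: "ev (evaluate F g) x (pair S P x s h) = act F h s"
      by (simp add: S_def P_def)
    have [simp]: "act F h s \<in> FOb F x"
      by (rule act_in[of F h g]) (use \<open>h \<in> Hom G g x\<close> in \<open>simp_all add: mem_Hom\<close>)
    have [simp]: "ev (trivialize F g) x (pair F P x (act F h s) h) = s"
      using inv(4)[of h x s] by (simp add: P_def)
    show "ev (trivialize F g \<cdot>\<^bsub>GS\<^esub> coext GS P (dup P) S (evaluate F g)) x w =
        ev (cofree_counit GS (bang P) S) x w"
      by (simp add: w ev_coext ev_cofree_counit)
  qed simp_all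
  show "evaluate F g \<cdot>\<^bsub>GS\<^esub> coext GS P (dup P) F (trivialize F g) = cofree_counit GS (bang P) F"
  proof (rule garr_eqI)
    fix x w assume [simp]: "x \<in> Ob G" and "w \<in> FOb (F \<otimes>\<^bsub>GS\<^esub> P) x"
    then obtain v h where w: "w = pair F P x v h" and [simp]: "v \<in> FOb F x" "h \<in> FOb P x"
      by (elim tensor_cases)
    have [simp]: "h \<in> Hom G g x"
      using \<open>h \<in> FOb P x\<close> by (simp add: P_def)
    have [simp]: "ev (trivialize F g) x (pair F P x v h) = act F (inv_ar G h) v"
      by (simp add: P_def)
    have [simp]: "act F (inv_ar G h) v \<in> FOb F g"
      by (rule act_in[of F "inv_ar G h" x]) (simp_all add: inv[of h x])
    have [simp]: "ev (evaluate F g) x (pair S P x (act F (inv_ar G h) v) h) = v"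
      using inv(5)[of h x v] by (simp add: S_def P_def)
    show "ev (evaluate F g \<cdot>\<^bsub>GS\<^esub> coext GS P (dup P) F (trivialize F g)) x w =
        ev (cofree_counit GS (bang P) F) x w"
      by (simp add: w ev_coext ev_cofree_counit)
  qed simp_all
qed

section \<open>Two colimits of G-sets\<close>

definition discrete :: "'u set \<Rightarrow> ('u, 'u) cat" where
  "discrete S = \<lparr>Ob = S, Ar = S, Src = id, Tgt = id, Ident = id, Cmp = (\<lambda>t s. s)\<rparr>"

lemma small_discrete: "small TYPE('u) S \<Longrightarrow> small_category (discrete S)"
  unfolding small_category_def by (auto simp: discrete_def category_def mem_Hom)

text \<open>
  A map from the terminal G-set to \<open>D\<close> is an invariant family of elements of \<open>D\<close>, and a map from
  \<open>const S\<close> to \<open>D\<close> is one such family for each \<open>s \<in> S\<close>.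
\<close>

lemma const_colimit:
  assumes S: "small TYPE('u) S"
  shows "colimit (discrete S) GS \<lparr>FOb = (\<lambda>_. Unit GS), FAr = (\<lambda>_. Ident GS (Unit GS))\<rparr>
    (const S) (\<lambda>s. garr (Unit GS) (const S) (\<lambda>_ _. s))"
    (is "colimit ?J GS ?K _ ?\<iota>")
proof -
  note [simp] = S
  have J: "category ?J" using small_discrete[OF S] by (simp add: small_category_def)
  have K: "is_functor ?J GS ?K"
    using J GS.category_axioms by (auto simp: is_functor_def is_functor_axioms_def mem_Hom)
  have \<iota>: "?\<iota> s \<in> Ar GS" if "s \<in> S" for s
    by (rule garr_in) (use that in auto)
  have cocone: "cocone ?J GS ?K (const S) ?\<iota>"
    using K \<iota> by (auto simp: cocone_def mem_Hom discrete_def)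
  have "\<exists>!h. h \<in> Hom GS (const S) D \<and> (\<forall>s \<in> Ob ?J. h \<cdot>\<^bsub>GS\<^esub> ?\<iota> s = \<kappa> s)"
    if "cocone ?J GS ?K D \<kappa>" for D \<kappa>
  proof -
    have [simp]: "D \<in> Ob GS" using that by (simp add: cocone_def)
    have \<kappa>: "\<kappa> s \<in> Ar GS" "Src GS (\<kappa> s) = Unit GS" "Tgt GS (\<kappa> s) = D"
      if "s \<in> S" for s
      using \<open>cocone ?J GS ?K D \<kappa>\<close> that by (auto simp: cocone_def discrete_def mem_Hom)
    let ?h = "garr (const S) D (\<lambda>x s. ev (\<kappa> s) x pt)"
    have h: "?h \<in> Ar GS"
    proof (rule garr_in)
      fix f x y s
      assume *: "f \<in> Ar G" "Src G f = x" "Tgt G f = y" "x \<in> Ob G" "y \<in> Ob G" "s \<in> FOb (const S) x"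
      thus "ev (\<kappa> (act (const S) f s)) y pt = act D f (ev (\<kappa> s) x pt)"
        using ev_act[OF \<kappa>(1), of s f x y pt] \<kappa>[of s] by simp
    qed (use \<kappa> in simp_all)
    show ?thesis
    proof (rule ex1I[of _ ?h], intro conjI ballI)
      fix s assume s: "s \<in> Ob ?J"
      hence [simp]: "s \<in> S" by (simp add: discrete_def)
      show "?h \<cdot>\<^bsub>GS\<^esub> ?\<iota> s = \<kappa> s"
        by (rule garr_eqI[where F = "Unit GS" and H = D]) (use \<iota> \<kappa> h in simp_all)
    next
      fix k assume k: "k \<in> Hom GS (const S) D \<and> (\<forall>s\<in>Ob ?J. k \<cdot>\<^bsub>GS\<^esub> ?\<iota> s = \<kappa> s)"
      show "k = ?h"
      proof (rule garr_eqI[where F = "const S" and H = D])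
        fix x s assume [simp]: "x \<in> Ob G" and "s \<in> FOb (const S) x"
        hence [simp]: "s \<in> S" by simp
        have "\<kappa> s = k \<cdot>\<^bsub>GS\<^esub> ?\<iota> s" using k by (simp add: discrete_def)
        thus "ev k x s = ev ?h x s" using k \<iota> by (simp add: mem_Hom)
      qed (use h k in \<open>simp_all add: mem_Hom\<close>)
    qed (use h in \<open>simp add: mem_Hom\<close>)
  qed
  thus ?thesis using cocone by (simp add: colimit_def)
qed

definition opposite :: "('u, 'u) cat" where
  "opposite = \<lparr>Ob = Ob G, Ar = Ar G, Src = Tgt G, Tgt = Src G, Ident = Ident G,
     Cmp = (\<lambda>g f. f \<cdot>\<^bsub>G\<^esub> g)\<rparr>"

definition yoneda :: "('u, 'u, 'u gset, ('u gset, 'u \<Rightarrow> ('u set, 'u \<Rightarrow> 'u) arrow) arrow) fctr" where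
  "yoneda = \<lparr>FOb = rep, FAr = (\<lambda>f. garr (rep (Tgt G f)) (rep (Src G f)) (\<lambda>_ h. h \<cdot>\<^bsub>G\<^esub> f))\<rparr>"

lemma small_opposite: "small_category opposite"
  using small unfolding small_category_def category_def[of opposite]
  by (auto simp: opposite_def mem_Hom)

lemma yoneda_in: "f \<in> Ar G \<Longrightarrow> FAr yoneda f \<in> Ar GS"
  unfolding yoneda_def fctr.simps by (rule garr_in) (auto simp: mem_Hom)

lemma functor_yoneda: "is_functor opposite GS yoneda"
proof -
  have eq: "FAr yoneda (Ident G x) = Ident GS (rep x)" if "x \<in> Ob G" for x
    by (rule garr_eqI[where F = "rep x"])
      (use that yoneda_in[of "Ident G x"] in \<open>auto simp: yoneda_def mem_Hom\<close>)
  have eq2: "FAr yoneda (g \<cdot>\<^bsub>G\<^esub> f) = FAr yoneda f \<cdot>\<^bsub>GS\<^esub> FAr yoneda g"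
    if "f \<in> Ar G" "g \<in> Ar G" "Src G g = Tgt G f" for f g
    by (rule garr_eqI[where F = "rep (Tgt G g)"])
      (use that yoneda_in[of f] yoneda_in[of g] yoneda_in[of "g \<cdot>\<^bsub>G\<^esub> f"] in
        \<open>auto simp: yoneda_def mem_Hom\<close>)
  show ?thesis
    unfolding is_functor_def is_functor_axioms_def
    using small_opposite GS.category_axioms yoneda_in eq eq2
    by (auto simp: small_category_def opposite_def mem_Hom) (auto simp: yoneda_def)
qed

text \<open>
  A cocone \<open>\<kappa>\<close> under the representables with vertex \<open>D\<close> is determined by the elements \<open>\<kappa> x (id\<^sub>x)\<close> of \<open>D(x)\<close>, since
  \<open>\<kappa> x\<close> takes \<open>f : x \<rightarrow> y\<close> to \<open>\<kappa> y (id\<^sub>y)\<close>. The same equation says that these elements form a global section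
  of \<open>D\<close>, that is, a map from the terminal G-set.
\<close>

lemma unit_colimit: "colimit opposite GS yoneda (Unit GS) (\<lambda>g. bang (rep g))"
proof -
  have cocone: "cocone opposite GS yoneda (Unit GS) (\<lambda>g. bang (rep g))"
    unfolding cocone_def
  proof (intro conjI ballI)
    show "is_functor opposite GS yoneda" by (rule functor_yoneda)
    fix f assume f: "f \<in> Ar opposite"
    hence [simp]: "f \<in> Ar G" by (simp add: opposite_def)
    show "bang (rep (Tgt opposite f)) \<cdot>\<^bsub>GS\<^esub> FAr yoneda f = bang (rep (Src opposite f))"
      by (rule garr_eqI[where F = "rep (Tgt G f)"])
        (use yoneda_in[of f] in \<open>auto simp: opposite_def yoneda_def mem_Hom\<close>)
  qed (auto simp: opposite_def yoneda_def mem_Hom)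
  have "\<exists>!h. h \<in> Hom GS (Unit GS) D \<and> (\<forall>g \<in> Ob opposite. h \<cdot>\<^bsub>GS\<^esub> bang (rep g) = \<kappa> g)"
    if "cocone opposite GS yoneda D \<kappa>" for D \<kappa>
  proof -
    have [simp]: "D \<in> Ob GS"
      and \<kappa> [simp]: "\<And>g. g \<in> Ob G \<Longrightarrow> \<kappa> g \<in> Ar GS" "\<And>g. g \<in> Ob G \<Longrightarrow> Src GS (\<kappa> g) = rep g"
      "\<And>g. g \<in> Ob G \<Longrightarrow> Tgt GS (\<kappa> g) = D"
      and nat: "\<And>f. f \<in> Ar G \<Longrightarrow> \<kappa> (Src G f) \<cdot>\<^bsub>GS\<^esub> FAr yoneda f = \<kappa> (Tgt G f)"
      using that by (auto simp: cocone_def opposite_def mem_Hom yoneda_def)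
    have \<kappa>_eq: "ev (\<kappa> x) y f = ev (\<kappa> y) y (Ident G y)"
      if [simp]: "f \<in> Ar G" "Src G f = x" "Tgt G f = y" for f x y
    proof -
      have [simp]: "x \<in> Ob G" "y \<in> Ob G" using Src_in[of f] Tgt_in[of f] by simp_all
      have "ev (\<kappa> y) y (Ident G y) = ev (\<kappa> x \<cdot>\<^bsub>GS\<^esub> FAr yoneda f) y (Ident G y)"
        using nat[of f] by simp
      also have "\<dots> = ev (\<kappa> x) y (ev (FAr yoneda f) y (Ident G y))"
        by (rule ev_Cmp) (use yoneda_in[of f] in \<open>simp_all add: yoneda_def mem_Hom\<close>)
      also have "ev (FAr yoneda f) y (Ident G y) = f"
        by (simp add: yoneda_def mem_Hom)
      finally show ?thesis by simp
    qed
    let ?h = "garr (Unit GS) D (\<lambda>x _. ev (\<kappa> x) x (Ident G x))"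
    have h: "?h \<in> Ar GS"
    proof (rule garr_in)
      fix f x y u
      assume *: "f \<in> Ar G" "Src G f = x" "Tgt G f = y" "x \<in> Ob G" "y \<in> Ob G"
      have "act D f (ev (\<kappa> x) x (Ident G x)) = ev (\<kappa> x) y (act (rep x) f (Ident G x))"
        using ev_act[of "\<kappa> x" f x y "Ident G x"] * by (simp add: mem_Hom)
      also have "\<dots> = ev (\<kappa> y) y (Ident G y)"
        using * \<kappa>_eq[of f x y] by (simp add: mem_Hom)
      finally show "ev (\<kappa> y) y (Ident G y) = act D f (ev (\<kappa> x) x (Ident G x))" ..
    qed (simp_all add: mem_Hom)
    show ?thesis
    proof (rule ex1I[of _ ?h], intro conjI ballI)
      fix g assume "g \<in> Ob opposite"
      hence [simp]: "g \<in> Ob G" by (simp add: opposite_def)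
      show "?h \<cdot>\<^bsub>GS\<^esub> bang (rep g) = \<kappa> g"
      proof (rule garr_eqI[where F = "rep g" and H = D])
        fix x f assume "x \<in> Ob G" "f \<in> FOb (rep g) x"
        thus "ev (?h \<cdot>\<^bsub>GS\<^esub> bang (rep g)) x f = ev (\<kappa> g) x f"
          using h \<kappa>_eq[of f g x] by (simp add: mem_Hom)
      qed (use h in simp_all)
    next
      fix k assume k: "k \<in> Hom GS (Unit GS) D \<and> (\<forall>g\<in>Ob opposite. k \<cdot>\<^bsub>GS\<^esub> bang (rep g) = \<kappa> g)"
      show "k = ?h"
      proof (rule garr_eqI[where F = "Unit GS" and H = D])
        fix x u assume [simp]: "x \<in> Ob G" and u: "u \<in> FOb (Unit GS) x"
        have "\<kappa> x = k \<cdot>\<^bsub>GS\<^esub> bang (rep x)" using k by (simp add: opposite_def)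
        thus "ev k x u = ev ?h x u" using k u by (simp add: mem_Hom)
      qed (use h k in \<open>simp_all add: mem_Hom\<close>)
    qed (use h in \<open>simp add: mem_Hom\<close>)
  qed
  thus ?thesis using cocone by (simp add: colimit_def)
qed

section \<open>Transformations out of the category of G-sets\<close>

text \<open>
  Invertibility is passed from constant G-sets to \<open>\<chi> F \<otimes> \<alpha> (rep g)\<close> by the coKleisli isomorphism
  \<open>trivialize F g\<close>, and from there to \<open>\<chi> F \<otimes> \<alpha> 1\<close> by taking the colimit over \<open>g\<close>.
\<close>

lemma component_iso:
  assumes A: "two_ring TYPE('u) A"
    and nt: "monoidal_nat_trans GS A \<alpha> \<beta> \<chi>"
    and \<alpha>: "cocontinuous TYPE('u) GS A \<alpha>" and \<beta>: "cocontinuous TYPE('u) GS A \<beta>"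
    and F [simp]: "F \<in> Ob GS"
  shows "is_iso A (\<chi> F)"
proof -
  interpret \<chi>: monoidal_nat_trans GS A \<alpha> \<beta> \<chi> by (rule nt)
  let ?i = "\<lambda>X. Ident A (FOb \<alpha> X)"
  have const: "is_iso A (\<chi> (const S))" if "small TYPE('u) S" for S
    by (rule component_iso_at_colimit[OF \<chi>.nat_trans_axioms \<alpha> \<beta> small_discrete const_colimit])
      (use that \<chi>.Unit_iso in simp_all)
  have rep: "is_iso A (\<chi> F \<boxtimes>\<^bsub>A\<^esub> ?i (rep g))" if [simp]: "g \<in> Ob G" for g
  proof -
    interpret g: comonoid_transformation GS A \<alpha> \<beta> \<chi> "rep g" "dup (rep g)" "bang (rep g)"
      by unfold_locales (simp add: diagonal_comonoid)
    show ?thesis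
      by (rule g.tensor_iso_of_coKleisli_iso[of "const (FOb F g)" F "trivialize F g" "evaluate F g"])
        (simp_all add: trivialize_evaluate const)
  qed
  have unit: "is_iso A (\<chi> F \<boxtimes>\<^bsub>A\<^esub> ?i (Unit GS))"
  proof (rule colimit_iso)
    have colim: "colimit opposite A (fctr_comp (tensor_left A X) (fctr_comp \<alpha> yoneda))
        (X \<otimes>\<^bsub>A\<^esub> FOb \<alpha> (Unit GS)) (\<lambda>g. Ident A X \<boxtimes>\<^bsub>A\<^esub> FAr \<alpha> (bang (rep g)))"
      if "X \<in> Ob A" for X
    proof -
      have "colimit opposite A (fctr_comp \<alpha> yoneda) (FOb \<alpha> (Unit GS)) (\<lambda>g. FAr \<alpha> (bang (rep g)))"
        using \<alpha> small_opposite unit_colimit unfolding cocontinuous_def preserves_colimits_def by blast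
      moreover have "preserves_colimits opposite A A (tensor_left A X)"
        using A that small_opposite by (auto simp: two_ring_def cocontinuous_def)
      ultimately show ?thesis
        unfolding preserves_colimits_def by (fastforce simp: tensor_left_def)
    qed
    show "colimit opposite A (fctr_comp (tensor_left A (FOb \<alpha> F)) (fctr_comp \<alpha> yoneda))
        (FOb \<alpha> F \<otimes>\<^bsub>A\<^esub> FOb \<alpha> (Unit GS)) (\<lambda>g. ?i F \<boxtimes>\<^bsub>A\<^esub> FAr \<alpha> (bang (rep g)))"
      by (rule colim) simp
    show "colimit opposite A (fctr_comp (tensor_left A (FOb \<beta> F)) (fctr_comp \<alpha> yoneda))
        (FOb \<beta> F \<otimes>\<^bsub>A\<^esub> FOb \<alpha> (Unit GS)) (\<lambda>g. Ident A (FOb \<beta> F) \<boxtimes>\<^bsub>A\<^esub> FAr \<alpha> (bang (rep g)))"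
      by (rule colim) simp
    fix g assume "g \<in> Ob opposite"
    hence [simp]: "g \<in> Ob G" by (simp add: opposite_def)
    show "\<chi> F \<boxtimes>\<^bsub>A\<^esub> ?i (rep g) \<in> Hom A
        (FOb (fctr_comp (tensor_left A (FOb \<alpha> F)) (fctr_comp \<alpha> yoneda)) g)
        (FOb (fctr_comp (tensor_left A (FOb \<beta> F)) (fctr_comp \<alpha> yoneda)) g)"
      by (simp add: mem_Hom fctr_comp_def tensor_left_def yoneda_def)
    show "is_iso A (\<chi> F \<boxtimes>\<^bsub>A\<^esub> ?i (rep g))" by (rule rep) simp
    show "(\<chi> F \<boxtimes>\<^bsub>A\<^esub> ?i (Unit GS)) \<cdot>\<^bsub>A\<^esub> (?i F \<boxtimes>\<^bsub>A\<^esub> FAr \<alpha> (bang (rep g))) =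
        (Ident A (FOb \<beta> F) \<boxtimes>\<^bsub>A\<^esub> FAr \<alpha> (bang (rep g))) \<cdot>\<^bsub>A\<^esub> (\<chi> F \<boxtimes>\<^bsub>A\<^esub> ?i (rep g))"
      by (simp add: \<chi>.F.D.interchange)
  next
    fix f assume "f \<in> Ar opposite"
    hence [simp]: "f \<in> Ar G" by (simp add: opposite_def)
    have [simp]: "FAr yoneda f \<in> Ar GS" "Src GS (FAr yoneda f) = rep (Tgt G f)"
      "Tgt GS (FAr yoneda f) = rep (Src G f)"
      using yoneda_in[of f] by (simp_all add: yoneda_def)
    show "(\<chi> F \<boxtimes>\<^bsub>A\<^esub> ?i (rep (Tgt opposite f))) \<cdot>\<^bsub>A\<^esub>
        FAr (fctr_comp (tensor_left A (FOb \<alpha> F)) (fctr_comp \<alpha> yoneda)) f =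
      FAr (fctr_comp (tensor_left A (FOb \<beta> F)) (fctr_comp \<alpha> yoneda)) f \<cdot>\<^bsub>A\<^esub>
        (\<chi> F \<boxtimes>\<^bsub>A\<^esub> ?i (rep (Src opposite f)))"
      by (simp add: fctr_comp_def tensor_left_def opposite_def \<chi>.F.D.interchange)
  qed (simp_all add: mem_Hom \<chi>.F.D.category_axioms)
  show ?thesis
    by (rule \<chi>.F.D.iso_of_tensor_iso[of _ "MUnit \<alpha>" "FOb \<alpha> (Unit GS)"]) (simp_all add: unit)
qed

end

theorem theorem3p2p14:
  fixes A :: "('o, 'a) symcat"
    and G :: "('u, 'u) cat"
    and \<alpha> \<beta> :: "('u gset, ('u gset, 'u \<Rightarrow> ('u set, 'u \<Rightarrow> 'u) arrow) arrow, 'o, 'a) monfctr"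
    and \<chi> :: "'u gset \<Rightarrow> 'a"
  assumes "inaccessible TYPE('u)"
    and "commutative_two_ring TYPE('u) A"
    and "small_category G" and "groupoid G"
    and "two_ring_1mor TYPE('u) (gset_sym G) A \<alpha>"
    and "two_ring_1mor TYPE('u) (gset_sym G) A \<beta>"
    and "two_ring_2mor TYPE('u) (gset_sym G) A \<alpha> \<beta> \<chi>"
  shows "two_ring_2iso TYPE('u) (gset_sym G) A \<alpha> \<beta> \<chi>"
proof -
  have nt: "monoidal_nat_trans (gset_sym G) A \<alpha> \<beta> \<chi>"
    using assms(7) by (simp add: two_ring_2mor_def)
  interpret \<chi>: monoidal_nat_trans "gset_sym G" A \<alpha> \<beta> \<chi> by (rule nt)
  interpret gsets G
    unfolding gsets_def gsets_axioms_def using assms(1,3,4) \<chi>.F.C.monoidal_category_axioms by blast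
  have iso: "is_iso A (\<chi> F)" if "F \<in> Ob GS" for F
    using component_iso[OF _ nt _ _ that] assms(2,5,6)
    by (simp add: commutative_two_ring_def two_ring_1mor_def)
  have "two_ring_2mor TYPE('u) GS A \<beta> \<alpha> (\<lambda>F. inv_ar A (\<chi> F))"
    using \<chi>.inverse_transformation[OF iso] assms(5,6) by (simp add: two_ring_2mor_def)
  thus ?thesis
    unfolding two_ring_2iso_def using assms(7) iso
    by (intro conjI exI[of _ "\<lambda>F. inv_ar A (\<chi> F)"]) simp_all
qed

end
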